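(* Let $(G,P)$ be a lattice ordered group and $X$ an associative product system of finite type over $P$ of right Hilbert $A$--$A$-bimodules such that the maps $\mathfrak m_{s,r}$ are bijective for all $s,r\in P$ and respect co-prime pairs. Let $N:G\to(0,\infty)$ be an injective homomorphism, with associated dynamics $\sigma^N$ on $\mathcal{NT}(X)$. If $\phi$ is a state of $\mathcal F$ such that $\phi|_{i_e(A)}$ is a trace and for some $0<\beta<\infty$ we have $$\phi\bigl(i_s(1^s_j)\,i_e(a)\,i_s(1^s_l)^*\bigr)=\delta_{j,l}\,N(s)^{-\beta}\,\phi(i_e(a))$$ for all $a\in A$, $s\in P$, $j,l=0,\dots,N_s-1$, then $\phi$ is a trace on $\mathcal F$. In particular, $\phi\circ\Phi^\delta$ is a KMS$_\beta$ state of $(\mathcal{NT}(X),\sigma^N)$.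
   Context: $A$ is a unital $C^*$-algebra. A right Hilbert $A$--$A$-bimodule is a right Hilbert $A$-module $Y$ (inner product $A$-valued, conjugate-linear in the first variable) with a $*$-homomorphism $\varphi:A\to\mathcal L(Y)$ (adjointable operators) giving the left action. $\theta_{\xi,\eta}(\zeta)=\xi\cdot\langle\eta,\zeta\rangle$ and $\mathcal K(Y)=\overline{\mathrm{span}}\{\theta_{\xi,\eta}\}$. The balanced tensor product $X\otimes_A Y$ has inner product $\langle\xi_1\otimes\eta_1,\xi_2\otimes\eta_2\rangle=\langle\langle\xi_2,\xi_1\rangle\cdot\eta_1,\eta_2\rangle$ and left action $a\mapsto\varphi(a)\otimes I$. $(G,P)$ is a lattice ordered group: $P$ is an abelian cancellative semigroup with identity $e$, $G=PP^{-1}$ is its Grothendieck enveloping group, $P\cap P^{-1}=\{e\}$, and any $s,r\in G$ have a least common upper bound $s\vee r\in G$ for the order $s\le r\Leftrightarrow s^{-1}r\in P$. For $s,r\in P$, $s\wedge r=(s\vee r)^{-1}sr$ is their greatest lower bound. A product system over $P$ is $X=\bigsqcup_{s\in P}X_s$ where each $X_s$ is a right Hilbert $A$--$A$-bimodule (inner product $\langle\cdot,\cdot\rangle_s$, left action $\varphi_s$, right action $\rho_s$, so $\rho_s(b)\xi=\xi\cdot b$), $X_e={}_AA_A$ with $\langle a,b\rangle=a^*b$, and $X$ is a semigroup with $X_sX_r\subseteq X_{sr}$, such that for $s,r\neq e$ the product extends to an isomorphism $F^{s,r}:X_s\otimes_AX_r\to X_{sr}$ of right Hilbert $A$--$A$-bimodules,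 while products with elements of $X_e=A$ are given by the bimodule actions. $X$ is associative if $F^{sr,q}(F^{s,r}\otimes_AI_q)=F^{s,rq}(I_s\otimes_AF^{r,q})$ for all $s,r,q\in P$. For $S\in\mathcal L(X_s)$, $i_s^{sr}(S)=F^{s,r}(S\otimes_AI_r)(F^{s,r})^*\in\mathcal L(X_{sr})$; $i_e^r=\varphi_r$, $i_s^s=\mathrm{id}$. $X$ is of finite type if for every $s\in P$ there are an integer $N_s\ge1$ and elements $1^s_0,\dots,1^s_{N_s-1}\in X_s$ with: (1) $X_s=\{\sum_j\varphi_s(a_j)1^s_j:a_j\in A\}$; (2) $X_s=\{\sum_j\rho_s(b_j)1^s_j:b_j\in A\}$; (3) $\langle1^s_j,1^s_k\rangle_s=\delta_{j,k}$; (4) for all $s,r\in P$ there is a map $\mathfrak m_{s,r}:\{0,\dots,N_s-1\}\times\{0,\dots,N_r-1\}\to\{0,\dots,N_{sr}-1\}$ with $F^{s,r}(1^s_j\otimes_A1^r_k)=1^{sr}_{\mathfrak m_{s,r}(j,k)}$. Then $\mathcal L(X_s)=\mathcal K(X_s)$ for all $s$, and $X$ is automatically compactly aligned, i.e. $i_s^{s\vee r}(S)i_r^{s\vee r}(T)\in\mathcal K(X_{s\vee r})$ for compact $S,T$. The maps $\mathfrak m_{s,r}$ respect co-prime pairs if for all $s,r\in P$ with $s\wedge r=e$, all $j,g,h\in\{0,\dots,N_s-1\}$ and all $l,m,n\in\{0,\dots,N_r-1\}$: $\mathfrak m_{s,r}(j,m)=\mathfrak m_{r,s}(l,g)$ and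 $\mathfrak m_{s,r}(j,n)=\mathfrak m_{r,s}(l,h)$ imply $m=n$ and $g=h$. A Toeplitz representation $\psi:X\to C$ in a $C^*$-algebra $C$: $\psi_s=\psi|_{X_s}$ linear, $\psi_e$ a $*$-homomorphism, $\psi_s(\xi)\psi_r(\eta)=\psi_{sr}(\xi\eta)$, and $\psi_s(\xi)^*\psi_s(\eta)=\psi_e(\langle\xi,\eta\rangle_s)$. It induces $*$-homomorphisms $\psi^{(s)}:\mathcal K(X_s)\to C$, $\psi^{(s)}(\theta_{\xi,\eta})=\psi_s(\xi)\psi_s(\eta)^*$. It is Nica covariant if $\psi^{(s)}(S)\psi^{(r)}(T)=\psi^{(s\vee r)}(i_s^{s\vee r}(S)i_r^{s\vee r}(T))$ for $s,r\in P$, $S\in\mathcal K(X_s)$, $T\in\mathcal K(X_r)$. $\mathcal{NT}(X)$ is the $C^*$-algebra generated by a universal Nica covariant Toeplitz representation $i_X$, with $i_s=i_X|_{X_s}$; it is the closed span of the elements $i_s(\xi)i_r(\eta)^*$. The core $\mathcal F$ is the closed span of the elements $i_s(\xi)i_s(\eta)^*$, $\xi,\eta\in X_s$, $s\in P$. There is a conditional expectation $\Phi^\delta:\mathcal{NT}(X)\to\mathcal F$ with $\Phi^\delta(i_s(\xi)i_r(\eta)^* )=\delta_{s,r}\,i_s(\xi)i_s(\eta)^*$. For a homomorphism $N:G\to(0,\infty)$ (multiplicative), $\sigma^N:\mathbb R\to\mathrm{Aut}(\mathcal{NT}(X))$ is the dynamics with $\sigma^N_t(i_e(a))=i_e(a)$,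 $\sigma^N_t(i_s(\xi))=N(s)^{it}i_s(\xi)$. An element $c$ is $\sigma$-analytic if $t\mapsto\sigma_t(c)$ extends to an entire function. For $0<\beta<\infty$, a KMS$_\beta$ state of $(C,\sigma)$ is a state $\omega$ with $\omega(cd)=\omega(d\sigma_{i\beta}(c))$ for all $\sigma$-analytic $c,d$ (it suffices to check this on a set of analytic elements spanning a dense subspace). *)

theory Defs
  imports "HOL-Complex_Analysis.Complex_Analysis" "HOL-Library.Lattice_Algebras"
begin

class scaleC =
  fixes scaleC :: "complex \<Rightarrow> 'a \<Rightarrow> 'a"  (infixr "*\<^sub>C" 75)

class complex_vector = scaleC + ab_group_add +
  assumes scaleC_add_right: "c *\<^sub>C (x + y) = c *\<^sub>C x + c *\<^sub>C y"
    and scaleC_add_left: "(c + d) *\<^sub>C x = c *\<^sub>C x + d *\<^sub>C x"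
    and scaleC_scaleC: "c *\<^sub>C d *\<^sub>C x = (c * d) *\<^sub>C x"
    and scaleC_one: "1 *\<^sub>C x = x"

class cstar_algebra = complex_vector + banach + real_normed_algebra_1 +
  fixes star :: "'a \<Rightarrow> 'a"
  assumes scaleR_scaleC: "r *\<^sub>R x = complex_of_real r *\<^sub>C x"
    and norm_scaleC: "norm (c *\<^sub>C x) = cmod c * norm x"
    and mult_scaleC_left: "(c *\<^sub>C x) * y = c *\<^sub>C (x * y)"
    and mult_scaleC_right: "x * (c *\<^sub>C y) = c *\<^sub>C (x * y)"
    and star_star: "star (star x) = x"
    and star_add: "star (x + y) = star x + star y"
    and star_scaleC: "star (c *\<^sub>C x) = cnj c *\<^sub>C star x"
    and star_mult: "star (x * y) = star y * star x"
    and cstar_identity: "norm (star x * x) = (norm x)\<^sup>2"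

definition csubspace :: "'a::complex_vector set \<Rightarrow> bool" where
  "csubspace S \<longleftrightarrow>
     0 \<in> S \<and> (\<forall>x\<in>S. \<forall>y\<in>S. x + y \<in> S) \<and> (\<forall>c. \<forall>x\<in>S. c *\<^sub>C x \<in> S)"

definition cstar_subalgebra :: "'a::cstar_algebra set \<Rightarrow> bool" where
  "cstar_subalgebra S \<longleftrightarrow>
     csubspace S \<and> closed S \<and> (\<forall>x\<in>S. \<forall>y\<in>S. x * y \<in> S) \<and> (\<forall>x\<in>S. star x \<in> S)"

definition positive_in :: "'a::cstar_algebra set \<Rightarrow> 'a \<Rightarrow> bool" where
  "positive_in D x \<longleftrightarrow> (\<exists>y\<in>D. x = star y * y)"

text \<open>
  The universal property of the Nica--Toeplitz algebra ranges over all C*-algebras, not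
  necessarily unital, so its targets cannot be types of class \<open>cstar_algebra\<close>. The operator
  algebras of a Hilbert module are presented in the same format.
\<close>

record 'c calg =
  carr :: "'c set"
  czero :: 'c
  cadd :: "'c \<Rightarrow> 'c \<Rightarrow> 'c"
  cscale :: "complex \<Rightarrow> 'c \<Rightarrow> 'c"
  cmult :: "'c \<Rightarrow> 'c \<Rightarrow> 'c"
  cinvol :: "'c \<Rightarrow> 'c"
  cnrm :: "'c \<Rightarrow> real"

definition complete_wrt :: "'c set \<Rightarrow> ('c \<Rightarrow> 'c \<Rightarrow> real) \<Rightarrow> bool" where
  "complete_wrt S d \<longleftrightarrow>
     (\<forall>f::nat \<Rightarrow> 'c. (\<forall>k. f k \<in> S) \<and> (\<forall>\<epsilon>>0. \<exists>K. \<forall>k\<ge>K. \<forall>l\<ge>K. d (f k) (f l) < \<epsilon>) \<longrightarrow>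
        (\<exists>x\<in>S. (\<lambda>k. d (f k) x) \<longlonglongrightarrow> 0))"

definition cstar_on :: "'c calg \<Rightarrow> bool" where
  "cstar_on C \<longleftrightarrow>
     czero C \<in> carr C \<and>
     (\<forall>x\<in>carr C. \<forall>y\<in>carr C.
        cadd C x y \<in> carr C \<and> cmult C x y \<in> carr C \<and> cinvol C x \<in> carr C \<and>
        (\<forall>c. cscale C c x \<in> carr C)) \<and>
     (\<forall>x\<in>carr C. \<forall>y\<in>carr C. \<forall>z\<in>carr C.
        cadd C (cadd C x y) z = cadd C x (cadd C y z) \<and>
        cadd C x y = cadd C y x \<and>
        cadd C (czero C) x = x \<and>
        cadd C x (cscale C (- 1) x) = czero C \<and>
        cmult C (cmult C x y) z = cmult C x (cmult C y z) \<and>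
        cmult C (cadd C x y) z = cadd C (cmult C x z) (cmult C y z) \<and>
        cmult C x (cadd C y z) = cadd C (cmult C x y) (cmult C x z) \<and>
        cinvol C (cinvol C x) = x \<and>
        cinvol C (cadd C x y) = cadd C (cinvol C x) (cinvol C y) \<and>
        cinvol C (cmult C x y) = cmult C (cinvol C y) (cinvol C x)) \<and>
     (\<forall>c d. \<forall>x\<in>carr C. \<forall>y\<in>carr C.
        cscale C c (cadd C x y) = cadd C (cscale C c x) (cscale C c y) \<and>
        cscale C (c + d) x = cadd C (cscale C c x) (cscale C d x) \<and>
        cscale C c (cscale C d x) = cscale C (c * d) x \<and>
        cscale C 1 x = x \<and>
        cmult C (cscale C c x) y = cscale C c (cmult C x y) \<and>
        cmult C x (cscale C c y) = cscale C c (cmult C x y) \<and>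
        cinvol C (cscale C c x) = cscale C (cnj c) (cinvol C x)) \<and>
     (\<forall>c. \<forall>x\<in>carr C. \<forall>y\<in>carr C.
        0 \<le> cnrm C x \<and> (cnrm C x = 0 \<longleftrightarrow> x = czero C) \<and>
        cnrm C (cadd C x y) \<le> cnrm C x + cnrm C y \<and>
        cnrm C (cscale C c x) = cmod c * cnrm C x \<and>
        cnrm C (cmult C x y) \<le> cnrm C x * cnrm C y \<and>
        cnrm C (cmult C (cinvol C x) x) = (cnrm C x)\<^sup>2) \<and>
     complete_wrt (carr C) (\<lambda>x y. cnrm C (cadd C x (cscale C (- 1) y)))"

definition star_hom :: "'c calg \<Rightarrow> 'd calg \<Rightarrow> ('c \<Rightarrow> 'd) \<Rightarrow> bool" where
  "star_hom C D h \<longleftrightarrow>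
     (\<forall>x\<in>carr C. h x \<in> carr D) \<and>
     (\<forall>x\<in>carr C. \<forall>y\<in>carr C. h (cadd C x y) = cadd D (h x) (h y)) \<and>
     (\<forall>c. \<forall>x\<in>carr C. h (cscale C c x) = cscale D c (h x)) \<and>
     (\<forall>x\<in>carr C. \<forall>y\<in>carr C. h (cmult C x y) = cmult D (h x) (h y)) \<and>
     (\<forall>x\<in>carr C. h (cinvol C x) = cinvol D (h x))"

definition type_alg :: "'b::cstar_algebra calg" where
  "type_alg = \<lparr>carr = UNIV, czero = 0, cadd = (+), cscale = (*\<^sub>C), cmult = (*),
     cinvol = star, cnrm = norm\<rparr>"

lemma scaleC_minus_one: "(- 1) *\<^sub>C (x::'a::complex_vector) = - x"
proof -
  have "(- 1) *\<^sub>C x + (- 1) *\<^sub>C x + x + x = (- 1 + (- 1) + 1 + 1) *\<^sub>C x"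
    by (simp only: scaleC_add_left scaleC_one)
  moreover have z: "0 *\<^sub>C x = 0"
    using scaleC_add_left[of 0 0 x] by simp
  moreover have "(- 1) *\<^sub>C x + x = (- 1 + 1) *\<^sub>C x"
    by (simp only: scaleC_add_left scaleC_one)
  ultimately show ?thesis
    by (simp add: eq_neg_iff_add_eq_0)
qed

lemma cstar_on_type_alg: "cstar_on (type_alg :: 'b::cstar_algebra calg)"
proof -
  have "(\<lambda>x y::'b. norm (x + - 1 *\<^sub>C y)) = dist"
    by (intro ext) (simp add: dist_norm scaleC_minus_one)
  moreover have "complete_wrt (UNIV :: 'b set) dist"
    unfolding complete_wrt_def
  proof (intro allI impI)
    fix f :: "nat \<Rightarrow> 'b"
    assume "(\<forall>k. f k \<in> UNIV) \<and> (\<forall>\<epsilon>>0. \<exists>K. \<forall>k\<ge>K. \<forall>l\<ge>K. dist (f k) (f l) < \<epsilon>)"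
    then have "Cauchy f"
      by (auto simp: Cauchy_def)
    then obtain x where "f \<longlonglongrightarrow> x"
      using Cauchy_convergent convergent_def by blast
    then show "\<exists>x\<in>UNIV. (\<lambda>k. dist (f k) x) \<longlonglongrightarrow> 0"
      using tendsto_dist_iff by auto
  qed
  ultimately show ?thesis
    by (simp add: cstar_on_def type_alg_def algebra_simps scaleC_minus_one norm_triangle_ineq
        norm_mult_ineq scaleC_add_right scaleC_add_left scaleC_scaleC scaleC_one norm_scaleC
        mult_scaleC_left mult_scaleC_right star_star star_add star_scaleC star_mult cstar_identity)
qed

text \<open>
  The underlying vector space is a subspace of an ambient complex vector space. The fields
  \<open>hip\<close>, \<open>ract\<close> and \<open>lact\<close> are the algebra-valued inner product, the right action
  \<open>\<xi> \<cdot> a\<close> and the left action \<open>\<phi>(a) \<xi>\<close>.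
\<close>

record ('a, 'x) hbimod =
  hspace :: "'x set"
  hip :: "'x \<Rightarrow> 'x \<Rightarrow> 'a"
  ract :: "'x \<Rightarrow> 'a \<Rightarrow> 'x"
  lact :: "'a \<Rightarrow> 'x \<Rightarrow> 'x"

definition hnorm :: "('a::cstar_algebra, 'x::complex_vector) hbimod \<Rightarrow> 'x \<Rightarrow> real" where
  "hnorm Y \<xi> = sqrt (norm (hip Y \<xi> \<xi>))"

definition hilbert_module :: "('a::cstar_algebra, 'x::complex_vector) hbimod \<Rightarrow> bool" where
  "hilbert_module Y \<longleftrightarrow>
     csubspace (hspace Y) \<and>
     (\<forall>\<xi>\<in>hspace Y. \<forall>a. ract Y \<xi> a \<in> hspace Y) \<and>
     (\<forall>\<xi>\<in>hspace Y. \<forall>\<eta>\<in>hspace Y. \<forall>a. ract Y (\<xi> + \<eta>) a = ract Y \<xi> a + ract Y \<eta> a) \<and>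
     (\<forall>\<xi>\<in>hspace Y. \<forall>a b. ract Y \<xi> (a + b) = ract Y \<xi> a + ract Y \<xi> b) \<and>
     (\<forall>\<xi>\<in>hspace Y. \<forall>a b. ract Y (ract Y \<xi> a) b = ract Y \<xi> (a * b)) \<and>
     (\<forall>\<xi>\<in>hspace Y. ract Y \<xi> 1 = \<xi>) \<and>
     (\<forall>c. \<forall>\<xi>\<in>hspace Y. \<forall>a. ract Y (c *\<^sub>C \<xi>) a = c *\<^sub>C ract Y \<xi> a \<and>
        ract Y \<xi> (c *\<^sub>C a) = c *\<^sub>C ract Y \<xi> a) \<and>
     (\<forall>\<xi>\<in>hspace Y. \<forall>\<eta>\<in>hspace Y. \<forall>\<zeta>\<in>hspace Y.
        hip Y \<xi> (\<eta> + \<zeta>) = hip Y \<xi> \<eta> + hip Y \<xi> \<zeta>) \<and>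
     (\<forall>c. \<forall>\<xi>\<in>hspace Y. \<forall>\<eta>\<in>hspace Y. hip Y \<xi> (c *\<^sub>C \<eta>) = c *\<^sub>C hip Y \<xi> \<eta>) \<and>
     (\<forall>\<xi>\<in>hspace Y. \<forall>\<eta>\<in>hspace Y. \<forall>a. hip Y \<xi> (ract Y \<eta> a) = hip Y \<xi> \<eta> * a) \<and>
     (\<forall>\<xi>\<in>hspace Y. \<forall>\<eta>\<in>hspace Y. star (hip Y \<xi> \<eta>) = hip Y \<eta> \<xi>) \<and>
     (\<forall>\<xi>\<in>hspace Y. positive_in UNIV (hip Y \<xi> \<xi>)) \<and>
     (\<forall>\<xi>\<in>hspace Y. hip Y \<xi> \<xi> = 0 \<longrightarrow> \<xi> = 0) \<and>
     complete_wrt (hspace Y) (\<lambda>\<xi> \<eta>. hnorm Y (\<xi> - \<eta>))"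

text \<open>
  An operator on \<open>Y\<close> is encoded as a function on the ambient space vanishing off \<open>Y\<close>, so that
  equality of operators is equality of functions.
\<close>

definition is_adjoint ::
  "('a::cstar_algebra, 'x::complex_vector) hbimod \<Rightarrow> ('x \<Rightarrow> 'x) \<Rightarrow> ('x \<Rightarrow> 'x) \<Rightarrow> bool" where
  "is_adjoint Y S T \<longleftrightarrow>
     (\<forall>\<xi>\<in>hspace Y. S \<xi> \<in> hspace Y \<and> T \<xi> \<in> hspace Y) \<and>
     (\<forall>\<xi>. \<xi> \<notin> hspace Y \<longrightarrow> S \<xi> = 0 \<and> T \<xi> = 0) \<and>
     (\<forall>\<xi>\<in>hspace Y. \<forall>\<eta>\<in>hspace Y. hip Y (S \<xi>) \<eta> = hip Y \<xi> (T \<eta>))"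

definition op_norm ::
  "('a::cstar_algebra, 'x::complex_vector) hbimod \<Rightarrow> ('x \<Rightarrow> 'x) \<Rightarrow> real" where
  "op_norm Y S = (SUP \<xi>\<in>{\<xi> \<in> hspace Y. hnorm Y \<xi> \<le> 1}. hnorm Y (S \<xi>))"

definition adjointables ::
  "('a::cstar_algebra, 'x::complex_vector) hbimod \<Rightarrow> ('x \<Rightarrow> 'x) calg" where
  "adjointables Y =
     \<lparr>carr = {S. \<exists>T. is_adjoint Y S T},
      czero = (\<lambda>_. 0),
      cadd = (\<lambda>S T \<xi>. S \<xi> + T \<xi>),
      cscale = (\<lambda>c S \<xi>. c *\<^sub>C S \<xi>),
      cmult = (\<lambda>S T. S \<circ> T),
      cinvol = (\<lambda>S. THE T. is_adjoint Y S T),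
      cnrm = op_norm Y\<rparr>"

definition theta ::
  "('a::cstar_algebra, 'x::complex_vector) hbimod \<Rightarrow> 'x \<Rightarrow> 'x \<Rightarrow> 'x \<Rightarrow> 'x" where
  "theta Y \<xi> \<eta> = (\<lambda>\<zeta>. if \<zeta> \<in> hspace Y then ract Y \<xi> (hip Y \<eta> \<zeta>) else 0)"

text \<open>Scalars are absorbed in the first argument of \<open>theta\<close>, so finite sums give the span.\<close>

definition theta_span ::
  "('a::cstar_algebra, 'x::complex_vector) hbimod \<Rightarrow> ('x \<Rightarrow> 'x) set" where
  "theta_span Y =
     {(\<lambda>\<zeta>. \<Sum>k<n. theta Y (\<xi> k) (\<eta> k) \<zeta>) | n \<xi> \<eta>.
        \<forall>k<(n::nat). \<xi> k \<in> hspace Y \<and> \<eta> k \<in> hspace Y}"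

definition compacts ::
  "('a::cstar_algebra, 'x::complex_vector) hbimod \<Rightarrow> ('x \<Rightarrow> 'x) calg" where
  "compacts Y = (adjointables Y)\<lparr>carr :=
     {S \<in> carr (adjointables Y).
        \<forall>\<epsilon>>0. \<exists>R\<in>theta_span Y. op_norm Y (\<lambda>\<xi>. S \<xi> - R \<xi>) < \<epsilon>}\<rparr>"

definition left_op ::
  "('a::cstar_algebra, 'x::complex_vector) hbimod \<Rightarrow> 'a \<Rightarrow> 'x \<Rightarrow> 'x" where
  "left_op Y a = (\<lambda>\<xi>. if \<xi> \<in> hspace Y then lact Y a \<xi> else 0)"

definition hilbert_bimodule :: "('a::cstar_algebra, 'x::complex_vector) hbimod \<Rightarrow> bool" where
  "hilbert_bimodule Y \<longleftrightarrow> hilbert_module Y \<and> star_hom type_alg (adjointables Y) (left_op Y)"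

definition bimodule_iso ::
  "('a::cstar_algebra, 'x::complex_vector) hbimod \<Rightarrow> ('a, 'x) hbimod \<Rightarrow> ('x \<Rightarrow> 'x) \<Rightarrow> bool" where
  "bimodule_iso Y Z F \<longleftrightarrow>
     bij_betw F (hspace Y) (hspace Z) \<and>
     (\<forall>\<xi>\<in>hspace Y. \<forall>\<eta>\<in>hspace Y. F (\<xi> + \<eta>) = F \<xi> + F \<eta>) \<and>
     (\<forall>c. \<forall>\<xi>\<in>hspace Y. F (c *\<^sub>C \<xi>) = c *\<^sub>C F \<xi>) \<and>
     (\<forall>\<xi>\<in>hspace Y. \<forall>\<eta>\<in>hspace Y. hip Z (F \<xi>) (F \<eta>) = hip Y \<xi> \<eta>) \<and>
     (\<forall>\<xi>\<in>hspace Y. \<forall>a. F (ract Y \<xi> a) = ract Z (F \<xi>) a \<and> F (lact Y a \<xi>) = lact Z a (F \<xi>))"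

text \<open>
  \<open>(W, t)\<close> is a model of the balanced tensor product of \<open>Y\<close> and \<open>Z\<close>, with
  \<open>t \<xi> \<eta>\<close> in the role of \<open>\<xi> \<otimes> \<eta>\<close>: balanced elementary tensors with the
  prescribed inner products and actions, spanning a dense subspace of the complete module
  \<open>W\<close>. Such a model is unique up to a unique isomorphism respecting elementary tensors.
\<close>

definition balanced_tensor ::
  "('a::cstar_algebra, 'x::complex_vector) hbimod \<Rightarrow> ('a, 'x) hbimod \<Rightarrow>
   ('a, 'x) hbimod \<Rightarrow> ('x \<Rightarrow> 'x \<Rightarrow> 'x) \<Rightarrow> bool" where
  "balanced_tensor Y Z W t \<longleftrightarrow>
     hilbert_bimodule W \<and>
     (\<forall>\<xi>\<in>hspace Y. \<forall>\<eta>\<in>hspace Z. t \<xi> \<eta> \<in> hspace W) \<and>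
     (\<forall>\<xi>\<in>hspace Y. \<forall>\<xi>'\<in>hspace Y. \<forall>\<eta>\<in>hspace Z. t (\<xi> + \<xi>') \<eta> = t \<xi> \<eta> + t \<xi>' \<eta>) \<and>
     (\<forall>\<xi>\<in>hspace Y. \<forall>\<eta>\<in>hspace Z. \<forall>\<eta>'\<in>hspace Z. t \<xi> (\<eta> + \<eta>') = t \<xi> \<eta> + t \<xi> \<eta>') \<and>
     (\<forall>c. \<forall>\<xi>\<in>hspace Y. \<forall>\<eta>\<in>hspace Z.
        t (c *\<^sub>C \<xi>) \<eta> = c *\<^sub>C t \<xi> \<eta> \<and> t \<xi> (c *\<^sub>C \<eta>) = c *\<^sub>C t \<xi> \<eta>) \<and>
     (\<forall>\<xi>\<in>hspace Y. \<forall>\<eta>\<in>hspace Z. \<forall>a. t (ract Y \<xi> a) \<eta> = t \<xi> (lact Z a \<eta>)) \<and>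
     (\<forall>\<xi>\<in>hspace Y. \<forall>\<eta>\<in>hspace Z. \<forall>\<xi>'\<in>hspace Y. \<forall>\<eta>'\<in>hspace Z.
        hip W (t \<xi> \<eta>) (t \<xi>' \<eta>') = hip Z (lact Z (hip Y \<xi>' \<xi>) \<eta>) \<eta>') \<and>
     (\<forall>\<xi>\<in>hspace Y. \<forall>\<eta>\<in>hspace Z. \<forall>a.
        lact W a (t \<xi> \<eta>) = t (lact Y a \<xi>) \<eta> \<and> ract W (t \<xi> \<eta>) a = t \<xi> (ract Z \<eta> a)) \<and>
     (\<forall>\<tau>\<in>hspace W. \<forall>\<epsilon>>0.
        \<exists>\<sigma>\<in>csubspace hull {t \<xi> \<eta> | \<xi> \<eta>. \<xi> \<in> hspace Y \<and> \<eta> \<in> hspace Z}.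
          hnorm W (\<tau> - \<sigma>) < \<epsilon>)"

text \<open>
  A lattice ordered group \<open>(G, P)\<close> is a type of class \<open>lattice_ab_group_add\<close>, written
  additively, with \<open>P\<close> its positive cone; thus \<open>e\<close>, \<open>s r\<close>, \<open>s \<or> r\<close> and \<open>s \<and> r\<close> read
  \<open>0\<close>, \<open>s + r\<close>, \<open>sup s r\<close> and \<open>inf s r\<close>.
\<close>

lemma inf_eq_diff_sup: "inf s r = s + r - sup s (r::'g::lattice_ab_group_add)"
  by (metis add_eq_inf_sup add_diff_cancel_left')

lemma cone_generates:
  "\<exists>s r. 0 \<le> s \<and> 0 \<le> r \<and> g = s - (r::'g::lattice_ab_group_add)"
  by (rule exI[of _ "sup g 0"], rule exI[of _ "sup g 0 - g"]) simp

text \<open>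
  All fibres live in one ambient type, hence \<open>X\<^sub>e = A\<close> becomes an explicit identification
  \<open>emb\<close> of \<open>A\<close> with the fibre at \<open>0\<close>. The fibres are labelled by their index, so they need
  not be disjoint as sets, and the product carries the labels of its factors.
\<close>

record ('g, 'a, 'x) prodsys =
  fib :: "'g \<Rightarrow> ('a, 'x) hbimod"
  pmul :: "'g \<Rightarrow> 'g \<Rightarrow> 'x \<Rightarrow> 'x \<Rightarrow> 'x"
  emb :: "'a \<Rightarrow> 'x"

abbreviation fsp :: "('g, 'a, 'x) prodsys \<Rightarrow> 'g \<Rightarrow> 'x set" where
  "fsp X s \<equiv> hspace (fib X s)"

definition unit_fibre ::
  "('g::lattice_ab_group_add, 'a::cstar_algebra, 'x::complex_vector) prodsys \<Rightarrow> bool" where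
  "unit_fibre X \<longleftrightarrow>
     bij_betw (emb X) UNIV (fsp X 0) \<and>
     (\<forall>a b. emb X (a + b) = emb X a + emb X b) \<and>
     (\<forall>c a. emb X (c *\<^sub>C a) = c *\<^sub>C emb X a) \<and>
     (\<forall>a b. hip (fib X 0) (emb X a) (emb X b) = star a * b) \<and>
     (\<forall>a b. lact (fib X 0) a (emb X b) = emb X (a * b)) \<and>
     (\<forall>a b. ract (fib X 0) (emb X a) b = emb X (a * b))"

text \<open>
  The model \<open>W\<close> of the tensor product may be taken in the ambient type of the fibres without
  loss of generality: an isomorphism onto the fibre at \<open>s + r\<close> transports any model there.
\<close>

definition product_system ::
  "('g::lattice_ab_group_add, 'a::cstar_algebra, 'x::complex_vector) prodsys \<Rightarrow> bool" where
  "product_system X \<longleftrightarrow>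
     (\<forall>s\<ge>0. hilbert_bimodule (fib X s)) \<and>
     unit_fibre X \<and>
     (\<forall>s\<ge>0. \<forall>r\<ge>0. \<forall>\<xi>\<in>fsp X s. \<forall>\<eta>\<in>fsp X r. pmul X s r \<xi> \<eta> \<in> fsp X (s + r)) \<and>
     (\<forall>s\<ge>0. \<forall>r\<ge>0. s \<noteq> 0 \<longrightarrow> r \<noteq> 0 \<longrightarrow>
        (\<exists>W t F. balanced_tensor (fib X s) (fib X r) W t \<and>
           bimodule_iso W (fib X (s + r)) F \<and>
           (\<forall>\<xi>\<in>fsp X s. \<forall>\<eta>\<in>fsp X r. F (t \<xi> \<eta>) = pmul X s r \<xi> \<eta>))) \<and>
     (\<forall>s\<ge>0. \<forall>\<xi>\<in>fsp X s. \<forall>a.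
        pmul X 0 s (emb X a) \<xi> = lact (fib X s) a \<xi> \<and>
        pmul X s 0 \<xi> (emb X a) = ract (fib X s) \<xi> a)"

text \<open>
  The semigroup law of \<open>X\<close>, which is the identity
  \<open>F\<^sup>s\<^sup>r\<^sup>,\<^sup>q (F\<^sup>s\<^sup>,\<^sup>r \<otimes> I) = F\<^sup>s\<^sup>,\<^sup>r\<^sup>q (I \<otimes> F\<^sup>r\<^sup>,\<^sup>q)\<close> evaluated on elementary tensors.
\<close>

definition associative_system ::
  "('g::lattice_ab_group_add, 'a::cstar_algebra, 'x::complex_vector) prodsys \<Rightarrow> bool" where
  "associative_system X \<longleftrightarrow>
     (\<forall>s\<ge>0. \<forall>r\<ge>0. \<forall>q\<ge>0. \<forall>\<xi>\<in>fsp X s. \<forall>\<eta>\<in>fsp X r. \<forall>\<zeta>\<in>fsp X q.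
        pmul X (s + r) q (pmul X s r \<xi> \<eta>) \<zeta> = pmul X s (r + q) \<xi> (pmul X r q \<eta> \<zeta>))"

text \<open>
  \<open>amplify X s r S\<close> is \<open>F (S \<otimes> I) F\<^sup>*\<close>, where \<open>S \<otimes> I\<close> is the adjointable operator
  with \<open>(S \<otimes> I) (\<xi> \<otimes> \<eta>) = S \<xi> \<otimes> \<eta>\<close>, and \<open>F (\<xi> \<otimes> \<eta>) = \<xi> \<eta>\<close>. In the
  first case \<open>S\<close> is left multiplication by \<open>S 1\<close> on the algebra.
\<close>

definition amplify ::
  "('g::lattice_ab_group_add, 'a::cstar_algebra, 'x::complex_vector) prodsys \<Rightarrow>
   'g \<Rightarrow> 'g \<Rightarrow> ('x \<Rightarrow> 'x) \<Rightarrow> 'x \<Rightarrow> 'x" where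
  "amplify X s r S =
     (if s = 0 then left_op (fib X r) (inv (emb X) (S (emb X 1)))
      else if r = 0 then S
      else (THE T. T \<in> carr (adjointables (fib X (s + r))) \<and>
              (\<forall>\<xi>\<in>fsp X s. \<forall>\<eta>\<in>fsp X r. T (pmul X s r \<xi> \<eta>) = pmul X s r (S \<xi>) \<eta>)))"

text \<open>\<open>u s j\<close> is \<open>1\<^sup>s\<^sub>j\<close>, for \<open>j < n s\<close>, and \<open>m s r\<close> is the index map of \<open>F\<^sup>s\<^sup>,\<^sup>r\<close>.\<close>

definition finite_type ::
  "('g::lattice_ab_group_add, 'a::cstar_algebra, 'x::complex_vector) prodsys \<Rightarrow>
   ('g \<Rightarrow> nat) \<Rightarrow> ('g \<Rightarrow> nat \<Rightarrow> 'x) \<Rightarrow> ('g \<Rightarrow> 'g \<Rightarrow> nat \<Rightarrow> nat \<Rightarrow> nat) \<Rightarrow> bool" where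
  "finite_type X n u m \<longleftrightarrow>
     (\<forall>s\<ge>0. 1 \<le> n s \<and> (\<forall>j<n s. u s j \<in> fsp X s) \<and>
        fsp X s = {\<Sum>j<n s. lact (fib X s) (a j) (u s j) | a. True} \<and>
        fsp X s = {\<Sum>j<n s. ract (fib X s) (u s j) (b j) | b. True} \<and>
        (\<forall>j<n s. \<forall>k<n s. hip (fib X s) (u s j) (u s k) = (if j = k then 1 else 0))) \<and>
     (\<forall>s\<ge>0. \<forall>r\<ge>0. \<forall>j<n s. \<forall>k<n r.
        m s r j k < n (s + r) \<and> pmul X s r (u s j) (u r k) = u (s + r) (m s r j k))"

definition bijective_maps ::
  "('g::lattice_ab_group_add \<Rightarrow> nat) \<Rightarrow> ('g \<Rightarrow> 'g \<Rightarrow> nat \<Rightarrow> nat \<Rightarrow> nat) \<Rightarrow> bool" where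
  "bijective_maps n m \<longleftrightarrow>
     (\<forall>s\<ge>0. \<forall>r\<ge>0. bij_betw (\<lambda>(j, k). m s r j k) ({..<n s} \<times> {..<n r}) {..<n (s + r)})"

definition respects_coprime ::
  "('g::lattice_ab_group_add \<Rightarrow> nat) \<Rightarrow> ('g \<Rightarrow> 'g \<Rightarrow> nat \<Rightarrow> nat \<Rightarrow> nat) \<Rightarrow> bool" where
  "respects_coprime n m \<longleftrightarrow>
     (\<forall>s\<ge>0. \<forall>r\<ge>0. inf s r = 0 \<longrightarrow>
        (\<forall>j<n s. \<forall>g<n s. \<forall>h<n s. \<forall>l<n r. \<forall>k<n r. \<forall>k'<n r.
           m s r j k = m r s l g \<and> m s r j k' = m r s l h \<longrightarrow> k = k' \<and> g = h))"

definition toeplitz_rep ::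
  "('g::lattice_ab_group_add, 'a::cstar_algebra, 'x::complex_vector) prodsys \<Rightarrow>
   'c calg \<Rightarrow> ('g \<Rightarrow> 'x \<Rightarrow> 'c) \<Rightarrow> bool" where
  "toeplitz_rep X C \<psi> \<longleftrightarrow>
     (\<forall>s\<ge>0. \<forall>\<xi>\<in>fsp X s. \<psi> s \<xi> \<in> carr C) \<and>
     (\<forall>s\<ge>0. \<forall>\<xi>\<in>fsp X s. \<forall>\<eta>\<in>fsp X s. \<psi> s (\<xi> + \<eta>) = cadd C (\<psi> s \<xi>) (\<psi> s \<eta>)) \<and>
     (\<forall>s\<ge>0. \<forall>c. \<forall>\<xi>\<in>fsp X s. \<psi> s (c *\<^sub>C \<xi>) = cscale C c (\<psi> s \<xi>)) \<and>
     star_hom type_alg C (\<lambda>a. \<psi> 0 (emb X a)) \<and>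
     (\<forall>s\<ge>0. \<forall>r\<ge>0. \<forall>\<xi>\<in>fsp X s. \<forall>\<eta>\<in>fsp X r.
        cmult C (\<psi> s \<xi>) (\<psi> r \<eta>) = \<psi> (s + r) (pmul X s r \<xi> \<eta>)) \<and>
     (\<forall>s\<ge>0. \<forall>\<xi>\<in>fsp X s. \<forall>\<eta>\<in>fsp X s.
        cmult C (cinvol C (\<psi> s \<xi>)) (\<psi> s \<eta>) = \<psi> 0 (emb X (hip (fib X s) \<xi> \<eta>)))"

text \<open>\<open>\<Psi> s\<close> is the homomorphism of compact operators induced by \<open>\<psi> s\<close>.\<close>

definition induced_homs ::
  "('g::lattice_ab_group_add, 'a::cstar_algebra, 'x::complex_vector) prodsys \<Rightarrow>
   'c calg \<Rightarrow> ('g \<Rightarrow> 'x \<Rightarrow> 'c) \<Rightarrow> ('g \<Rightarrow> ('x \<Rightarrow> 'x) \<Rightarrow> 'c) \<Rightarrow> bool" where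
  "induced_homs X C \<psi> \<Psi> \<longleftrightarrow>
     (\<forall>s\<ge>0. star_hom (compacts (fib X s)) C (\<Psi> s) \<and>
        (\<forall>\<xi>\<in>fsp X s. \<forall>\<eta>\<in>fsp X s.
           \<Psi> s (theta (fib X s) \<xi> \<eta>) = cmult C (\<psi> s \<xi>) (cinvol C (\<psi> s \<eta>))))"

text \<open>The induced homomorphisms exist and are unique, so \<open>\<exists>\<Psi>\<close> merely names them.\<close>

definition nica_covariant ::
  "('g::lattice_ab_group_add, 'a::cstar_algebra, 'x::complex_vector) prodsys \<Rightarrow>
   'c calg \<Rightarrow> ('g \<Rightarrow> 'x \<Rightarrow> 'c) \<Rightarrow> bool" where
  "nica_covariant X C \<psi> \<longleftrightarrow>
     (\<exists>\<Psi>. induced_homs X C \<psi> \<Psi> \<and>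
        (\<forall>s\<ge>0. \<forall>r\<ge>0. \<forall>S\<in>carr (compacts (fib X s)). \<forall>T\<in>carr (compacts (fib X r)).
           cmult C (\<Psi> s S) (\<Psi> r T) =
           \<Psi> (sup s r) (amplify X s (sup s r - s) S \<circ> amplify X r (sup s r - r) T)))"

text \<open>
  \<open>(\<open>'b\<close>, i)\<close> is a Nica--Toeplitz algebra of \<open>X\<close>. It suffices to test universality on
  C*-algebras carried by subsets of \<open>nat \<Rightarrow> 'g \<times> 'x\<close>: the C*-algebra generated by a
  representation consists of limits of sequences from a dense set with at most
  \<open>card ('g \<times> 'x)\<close> elements (\<open>'x\<close> is infinite, since it contains a copy of \<open>'a\<close>), so
  it is isomorphic to one of these. For \<open>X\<close> of finite type \<open>i\<^sub>e(1)\<close> is a unit of the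
  generated algebra, so asking \<open>'b\<close> to be unital is no restriction.
\<close>

definition nica_toeplitz_algebra ::
  "('g::lattice_ab_group_add, 'a::cstar_algebra, 'x::complex_vector) prodsys \<Rightarrow>
   ('g \<Rightarrow> 'x \<Rightarrow> 'b::cstar_algebra) \<Rightarrow> bool" where
  "nica_toeplitz_algebra X i \<longleftrightarrow>
     toeplitz_rep X type_alg i \<and> nica_covariant X type_alg i \<and>
     cstar_subalgebra hull {i s \<xi> | s \<xi>. 0 \<le> s \<and> \<xi> \<in> fsp X s} = UNIV \<and>
     (\<forall>(C :: (nat \<Rightarrow> 'g \<times> 'x) calg) \<psi>.
        cstar_on C \<and> toeplitz_rep X C \<psi> \<and> nica_covariant X C \<psi> \<longrightarrow>
        (\<exists>h. star_hom type_alg C h \<and> (\<forall>s\<ge>0. \<forall>\<xi>\<in>fsp X s. h (i s \<xi>) = \<psi> s \<xi>)))"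

definition core ::
  "('g::lattice_ab_group_add, 'a::cstar_algebra, 'x::complex_vector) prodsys \<Rightarrow>
   ('g \<Rightarrow> 'x \<Rightarrow> 'b::cstar_algebra) \<Rightarrow> 'b set" where
  "core X i = closure (csubspace hull
     {i s \<xi> * star (i s \<eta>) | s \<xi> \<eta>. 0 \<le> s \<and> \<xi> \<in> fsp X s \<and> \<eta> \<in> fsp X s})"

definition conditional_expectation :: "'b::cstar_algebra set \<Rightarrow> ('b \<Rightarrow> 'b) \<Rightarrow> bool" where
  "conditional_expectation D E \<longleftrightarrow>
     (\<forall>x. E x \<in> D) \<and> (\<forall>x\<in>D. E x = x) \<and>
     (\<forall>x y. E (x + y) = E x + E y) \<and> (\<forall>c x. E (c *\<^sub>C x) = c *\<^sub>C E x) \<and>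
     (\<forall>x. norm (E x) \<le> norm x) \<and>
     (\<forall>x. positive_in D (E (star x * x))) \<and>
     (\<forall>x. \<forall>a\<in>D. \<forall>b\<in>D. E (a * x * b) = a * E x * b)"

definition core_expectation ::
  "('g::lattice_ab_group_add, 'a::cstar_algebra, 'x::complex_vector) prodsys \<Rightarrow>
   ('g \<Rightarrow> 'x \<Rightarrow> 'b::cstar_algebra) \<Rightarrow> ('b \<Rightarrow> 'b) \<Rightarrow> bool" where
  "core_expectation X i E \<longleftrightarrow>
     conditional_expectation (core X i) E \<and>
     (\<forall>s\<ge>0. \<forall>r\<ge>0. \<forall>\<xi>\<in>fsp X s. \<forall>\<eta>\<in>fsp X r.
        E (i s \<xi> * star (i r \<eta>)) = (if s = r then i s \<xi> * star (i s \<eta>) else 0))"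

definition dynamics :: "(real \<Rightarrow> 'b::cstar_algebra \<Rightarrow> 'b) \<Rightarrow> bool" where
  "dynamics \<sigma> \<longleftrightarrow>
     (\<forall>t. star_hom type_alg type_alg (\<sigma> t)) \<and> \<sigma> 0 = id \<and>
     (\<forall>t t'. \<sigma> (t + t') = \<sigma> t \<circ> \<sigma> t') \<and> (\<forall>c. continuous_on UNIV (\<lambda>t. \<sigma> t c))"

definition positive_hom :: "('g::lattice_ab_group_add \<Rightarrow> real) \<Rightarrow> bool" where
  "positive_hom N \<longleftrightarrow> (\<forall>g. 0 < N g) \<and> (\<forall>g h. N (g + h) = N g * N h)"

definition scaling_dynamics ::
  "('g::lattice_ab_group_add, 'a::cstar_algebra, 'x::complex_vector) prodsys \<Rightarrow>
   ('g \<Rightarrow> 'x \<Rightarrow> 'b::cstar_algebra) \<Rightarrow> ('g \<Rightarrow> real) \<Rightarrow> (real \<Rightarrow> 'b \<Rightarrow> 'b) \<Rightarrow> bool" where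
  "scaling_dynamics X i N \<sigma> \<longleftrightarrow>
     dynamics \<sigma> \<and>
     (\<forall>t a. \<sigma> t (i 0 (emb X a)) = i 0 (emb X a)) \<and>
     (\<forall>t. \<forall>s\<ge>0. \<forall>\<xi>\<in>fsp X s.
        \<sigma> t (i s \<xi>) = (complex_of_real (N s) powr (\<i> * complex_of_real t)) *\<^sub>C i s \<xi>)"

definition entire :: "(complex \<Rightarrow> 'b::cstar_algebra) \<Rightarrow> bool" where
  "entire f \<longleftrightarrow> (\<forall>z. \<exists>D. ((\<lambda>w. (1 / (w - z)) *\<^sub>C (f w - f z)) \<longlongrightarrow> D) (at z))"

text \<open>\<open>f z\<close> is \<open>\<sigma>\<^sub>z(c)\<close>; an entire extension is unique when it exists.\<close>

definition entire_extension ::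
  "(real \<Rightarrow> 'b::cstar_algebra \<Rightarrow> 'b) \<Rightarrow> 'b \<Rightarrow> (complex \<Rightarrow> 'b) \<Rightarrow> bool" where
  "entire_extension \<sigma> c f \<longleftrightarrow> entire f \<and> (\<forall>t. f (complex_of_real t) = \<sigma> t c)"

definition state_on :: "'b::cstar_algebra set \<Rightarrow> ('b \<Rightarrow> complex) \<Rightarrow> bool" where
  "state_on D \<phi> \<longleftrightarrow>
     (\<forall>x\<in>D. \<forall>y\<in>D. \<phi> (x + y) = \<phi> x + \<phi> y) \<and>
     (\<forall>c. \<forall>x\<in>D. \<phi> (c *\<^sub>C x) = c * \<phi> x) \<and>
     (\<forall>x\<in>D. \<phi> (star x * x) \<in> \<real>\<^sub>\<ge>\<^sub>0) \<and>
     bdd_above ((\<lambda>x. cmod (\<phi> x)) ` {x \<in> D. norm x \<le> 1}) \<and>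
     (SUP x\<in>{x \<in> D. norm x \<le> 1}. cmod (\<phi> x)) = 1"

definition tracial_on :: "'b::cstar_algebra set \<Rightarrow> ('b \<Rightarrow> complex) \<Rightarrow> bool" where
  "tracial_on D \<phi> \<longleftrightarrow> (\<forall>x\<in>D. \<forall>y\<in>D. \<phi> (x * y) = \<phi> (y * x))"

definition kms_state ::
  "(real \<Rightarrow> 'b::cstar_algebra \<Rightarrow> 'b) \<Rightarrow> real \<Rightarrow> ('b \<Rightarrow> complex) \<Rightarrow> bool" where
  "kms_state \<sigma> \<beta> \<omega> \<longleftrightarrow>
     state_on UNIV \<omega> \<and>
     (\<forall>c d f g. entire_extension \<sigma> c f \<and> entire_extension \<sigma> d g \<longrightarrow>
        \<omega> (c * d) = \<omega> (d * f (\<i> * complex_of_real \<beta>)))"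

end

theory Submission
  imports Defs
begin

text \<open>
  Write \<open>v s j\<close> for \<open>i\<^sub>s(1\<^sup>s\<^sub>j)\<close> and \<open>\<pi> a\<close> for \<open>i\<^sub>e(a)\<close>; the words \<open>v s j \<pi>(a) (v r l)\<^sup>*\<close> have dense span.
  Nica covariance says that range projections of basis isometries over co-prime \<open>s, r\<close> multiply by
  intersecting index sets, whence \<open>(v s l)\<^sup>* v r k\<close> is the sum of \<open>v r q (v s p)\<^sup>*\<close> over the pairs with
  \<open>v s l v r q = v r k v s p\<close>. Dividing two indices by their greatest lower bound reduces every product
  of words to this case. For words \<open>c\<close> and \<open>d\<close> it turns \<open>\<omega> (c d)\<close> and \<open>\<omega> (d c)\<close>, where \<open>\<omega> = \<phi> \<circ> E\<close>, into the
  same double sum up to the trace property on \<open>A\<close> and the scalar by which \<open>\<sigma>\<^sub>i\<^sub>\<beta>\<close> scales \<open>d\<close>. This gives the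
  trace property on the core. For the KMS condition fix a word \<open>d\<close> and an analytic \<open>c\<close>: as \<open>\<omega>\<close> is
  \<open>\<sigma>\<close>-invariant, \<open>\<omega> (d \<sigma>\<^sub>t(c))\<close> is a multiple of an exponential for real \<open>t\<close>, so by the identity theorem
  also at \<open>i \<beta>\<close>. Invariance passes from words to the closure because the positive functional
  \<open>\<omega> \<circ> \<sigma>\<^sub>t\<close> is automatically bounded.
\<close>

section \<open>C*-algebras and bounded functionals\<close>

lemma scaleC_zero_left: "0 *\<^sub>C x = (0 :: 'a::complex_vector)"
  using scaleC_add_left[of 0 0 x] by simp

lemma bounded_linear_scaleC: "bounded_linear (\<lambda>x::'b::cstar_algebra. c *\<^sub>C x)"
  by (rule bounded_linear_intro[of _ "cmod c"])
    (simp_all add: scaleC_add_right scaleR_scaleC scaleC_scaleC norm_scaleC mult.commute)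

lemma star_zero: "star (0::'b::cstar_algebra) = 0"
  using star_add[of "0::'b" 0] by simp

lemma star_minus: "star (- x) = - star (x::'b::cstar_algebra)"
  using star_add[of x "- x"] by (simp add: star_zero eq_neg_iff_add_eq_0 add.commute)

lemma star_sum: "star (sum f A) = (\<Sum>x\<in>A. star (f x :: 'b::cstar_algebra))"
  by (induction A rule: infinite_finite_induct) (simp_all add: star_zero star_add)

lemma star_one: "star (1::'b::cstar_algebra) = 1"
  by (metis mult_1 mult.right_neutral star_mult star_star)

lemma star_power: "star ((x::'b::cstar_algebra) ^ k) = star x ^ k"
  by (induction k) (simp_all add: star_one star_mult power_commutes)

text \<open>The C*-identity and submultiplicativity of the norm give
  \<open>norm y \<le> norm (star y)\<close>; using this for both \<open>x\<close> and
  \<open>star x\<close> gives equality.\<close>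

lemma norm_star: "norm (star x) = norm (x::'b::cstar_algebra)"
proof -
  have le: "norm y \<le> norm (star y)" for y :: 'b
  proof (cases "norm y = 0")
    case False
    have "norm y * norm y \<le> norm (star y) * norm y"
      by (metis cstar_identity norm_mult_ineq power2_eq_square)
    with False show ?thesis by (simp add: mult_le_cancel_right)
  qed simp
  show ?thesis using le[of x] le[of "star x"] by (simp add: star_star)
qed

lemma bounded_linear_star: "bounded_linear (star :: 'b::cstar_algebra \<Rightarrow> 'b)"
  by (rule bounded_linear_intro[of _ 1]) (simp_all add: star_add scaleR_scaleC star_scaleC norm_star)

section \<open>Linear spans and their closures\<close>

lemma csubspace_hull: "csubspace (csubspace hull G)"
  by (rule hull_in) (auto simp: csubspace_def)

lemma csubspace_sum: "csubspace S \<Longrightarrow> (\<And>k. k \<in> A \<Longrightarrow> f k \<in> S) \<Longrightarrow> sum f A \<in> S"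
  by (induction A rule: infinite_finite_induct) (auto simp: csubspace_def)

lemma csubspace_uminus: "csubspace S \<Longrightarrow> x \<in> S \<Longrightarrow> - x \<in> S"
  by (metis csubspace_def scaleC_minus_one)

lemma csubspace_closure:
  fixes S :: "'b::cstar_algebra set"
  assumes "csubspace S"
  shows "csubspace (closure S)"
  unfolding csubspace_def
proof (intro conjI ballI allI)
  show "0 \<in> closure S"
    using assms closure_subset by (auto simp: csubspace_def)
next
  fix x y assume "x \<in> closure S" "y \<in> closure S"
  then obtain f g where "\<forall>k. f k \<in> S" "f \<longlonglongrightarrow> x" "\<forall>k. g k \<in> S" "g \<longlonglongrightarrow> y"
    by (auto simp: closure_sequential)
  with assms show "x + y \<in> closure S"
    unfolding closure_sequential
    by (intro exI[of _ "\<lambda>k. f k + g k"]) (auto simp: csubspace_def intro!: tendsto_add)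
next
  fix c x assume "x \<in> closure S"
  then obtain f where "\<forall>k. f k \<in> S" "f \<longlonglongrightarrow> x"
    by (auto simp: closure_sequential)
  with assms show "c *\<^sub>C x \<in> closure S"
    unfolding closure_sequential
    by (intro exI[of _ "\<lambda>k. c *\<^sub>C f k"])
      (auto simp: csubspace_def intro!: bounded_linear.tendsto[OF bounded_linear_scaleC])
qed

text \<open>The density argument used throughout: a property that cuts out a closed subspace has to
  be checked on generators only.\<close>

lemma closed_span_induct:
  fixes T :: "'b::cstar_algebra set"
  assumes "x \<in> closure (csubspace hull G)" "csubspace T" "closed T" "G \<subseteq> T"
  shows "x \<in> T"
  using closure_minimal[OF hull_minimal[OF assms(4), of csubspace, OF assms(2)] assms(3)] assms(1)
  by blast

text \<open>Continuity of multiplication in each variable extends closure under products first in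
  the left factor, then in the right one. Products of generators may land in the span only, because
  a product of two words is a finite sum of words.\<close>

lemma cstar_subalgebra_closed_span:
  fixes G :: "'b::cstar_algebra set"
  assumes mult: "\<And>x y. x \<in> G \<Longrightarrow> y \<in> G \<Longrightarrow> x * y \<in> csubspace hull G"
    and star: "\<And>x. x \<in> G \<Longrightarrow> star x \<in> G"
  shows "cstar_subalgebra (closure (csubspace hull G))" (is "cstar_subalgebra ?C")
proof -
  have sub: "csubspace ?C" by (rule csubspace_closure[OF csubspace_hull])
  have GC: "g \<in> ?C" if "g \<in> csubspace hull G" for g
    using that closure_subset by blast
  have G: "g \<in> ?C" if "g \<in> G" for g
    using that by (intro GC) (rule hull_inc)
  have left: "x * g \<in> ?C" if "x \<in> ?C" "g \<in> G" for x g
  proof -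
    have "x \<in> (\<lambda>y. y * g) -` ?C"
    proof (rule closed_span_induct[OF that(1)])
      show "csubspace ((\<lambda>y. y * g) -` ?C)"
        using sub by (auto simp: csubspace_def distrib_right mult_scaleC_left)
      show "closed ((\<lambda>y. y * g) -` ?C)"
        by (intro closed_vimage continuous_intros) simp
      show "G \<subseteq> (\<lambda>y. y * g) -` ?C"
        using GC[OF mult[OF _ that(2)]] by auto
    qed
    then show ?thesis by simp
  qed
  have prod: "x * y \<in> ?C" if "x \<in> ?C" "y \<in> ?C" for x y
  proof -
    have "y \<in> (\<lambda>z. x * z) -` ?C"
    proof (rule closed_span_induct[OF that(2)])
      show "csubspace ((\<lambda>z. x * z) -` ?C)"
        using sub by (auto simp: csubspace_def distrib_left mult_scaleC_right)
      show "closed ((\<lambda>z. x * z) -` ?C)"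
        by (intro closed_vimage continuous_intros) simp
      show "G \<subseteq> (\<lambda>z. x * z) -` ?C"
        using left[OF that(1)] by auto
    qed
    then show ?thesis by simp
  qed
  have "star x \<in> ?C" if "x \<in> ?C" for x
  proof -
    have "x \<in> star -` ?C"
    proof (rule closed_span_induct[OF that])
      show "csubspace (star -` ?C)"
        using sub by (auto simp: csubspace_def star_zero star_add star_scaleC)
      show "closed (star -` ?C)"
        by (intro closed_vimage linear_continuous_on bounded_linear_star) simp
      show "G \<subseteq> star -` ?C"
        using G star by auto
    qed
    then show ?thesis by simp
  qed
  with sub prod show ?thesis
    by (simp add: cstar_subalgebra_def)
qed

text \<open>The root \<open>y\<close> is the binomial series of exponent 1/2 in \<open>- a\<close>,
  absolutely convergent because \<open>norm a < 1\<close>. By Vandermonde's identity its Cauchy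
  square is the series of exponent 1, where only the terms 0 and 1 survive.\<close>

lemma one_minus_selfadjoint_square:
  fixes a :: "'b::cstar_algebra"
  assumes a: "norm a < 1" "star a = a"
  obtains y where "star y = y" "1 - a = y * y"
proof -
  define c where "c k = ((1/2::real) gchoose k)" for k
  define f where "f k = c k *\<^sub>R (- a) ^ k" for k
  have "summable (\<lambda>k. norm (c k * norm a ^ k))"
    using a(1) unfolding c_def
    by (intro abs_summable_in_conv_radius) (auto simp: conv_radius_gchoose)
  then have sf: "summable (\<lambda>k. norm (f k))"
  proof (rule summable_comparison_test'[of _ 0])
    show "norm (norm (f k)) \<le> norm (c k * norm a ^ k)" for k
      using norm_power_ineq[of "- a" k] by (auto simp: f_def abs_mult intro!: mult_left_mono)
  qed
  define y where "y = (\<Sum>k. f k)"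
  have "star y = (\<Sum>k. star (f k))"
    unfolding y_def
    by (rule bounded_linear.suminf[OF bounded_linear_star summable_norm_cancel[OF sf]])
  also have "\<dots> = y"
    by (simp add: y_def f_def scaleR_scaleC star_scaleC star_power star_minus a)
  finally have sy: "star y = y" .
  have conv: "(\<Sum>j\<le>k. f j * f (k - j)) = ((1::real) gchoose k) *\<^sub>R (- a) ^ k" for k
  proof -
    have "(\<Sum>j\<le>k. f j * f (k - j)) = (\<Sum>j\<le>k. c j * c (k - j)) *\<^sub>R (- a) ^ k"
      by (simp add: f_def scaleR_sum_left mult.commute[of "c (k - _)"] flip: power_add)
    also have "(\<Sum>j\<le>k. c j * c (k - j)) = ((1::real) gchoose k)"
      using gbinomial_Vandermonde[of "1/2::real" "1/2" k] by (simp add: c_def atMost_atLeast0)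
    finally show ?thesis .
  qed
  have zero: "((1::real) gchoose k) = 0" if "k \<notin> {0, 1}" for k
    using that binomial_gbinomial[of 1 k, where ?'a = real] by (simp add: binomial_eq_0)
  have "y * y = (\<Sum>k. ((1::real) gchoose k) *\<^sub>R (- a) ^ k)"
    unfolding y_def Cauchy_product[OF sf sf] conv ..
  also have "\<dots> = (\<Sum>k\<in>{0,1}. ((1::real) gchoose k) *\<^sub>R (- a) ^ k)"
    by (rule suminf_finite) (use zero in auto)
  also have "\<dots> = 1 - a" by simp
  finally show thesis using sy that by metis
qed

text \<open>Complex linearity and boundedness in one predicate, whereas
  \<open>bounded_linear\<close> records real linearity only. The constant \<open>K\<close> may be
  negative, hence the absolute values in the estimates below.\<close>

definition bounded_functional :: "('b::cstar_algebra \<Rightarrow> complex) \<Rightarrow> bool" where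
  "bounded_functional L \<longleftrightarrow>
     (\<forall>x y. L (x + y) = L x + L y) \<and> (\<forall>c x. L (c *\<^sub>C x) = c * L x) \<and>
     (\<exists>K. \<forall>x. cmod (L x) \<le> K * norm x)"

lemma bounded_functional_bounded_linear: "bounded_functional L \<Longrightarrow> bounded_linear L"
  unfolding bounded_functional_def
  by (elim conjE exE, rule bounded_linear_intro)
    (auto simp: scaleR_scaleC scaleR_conv_of_real mult.commute[of "norm _"])

lemma bounded_functional_sum: "bounded_functional L \<Longrightarrow> L (sum f A) = (\<Sum>x\<in>A. L (f x))"
  by (simp add: bounded_functional_bounded_linear bounded_linear.linear linear_sum)

lemma bounded_functional_zero: "bounded_functional L \<Longrightarrow> L 0 = 0"
  using bounded_functional_sum[of L _ "{}"] by simp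

lemma bounded_functional_diff: "bounded_functional L \<Longrightarrow> L (x - y) = L x - L y"
  by (simp add: bounded_functional_bounded_linear bounded_linear.linear linear_diff)

lemma bounded_functional_lincomb:
  assumes "bounded_functional L" "bounded_functional M"
  shows "bounded_functional (\<lambda>x. L x - c * M x)"
proof -
  obtain K K' where K: "\<And>x. cmod (L x) \<le> K * norm x" "\<And>x. cmod (M x) \<le> K' * norm x"
    using assms by (auto simp: bounded_functional_def)
  have "cmod (L x - c * M x) \<le> (K + cmod c * K') * norm x" for x
  proof -
    have "cmod (L x - c * M x) \<le> cmod (L x) + cmod c * cmod (M x)"
      by (metis norm_mult norm_triangle_ineq4)
    also have "\<dots> \<le> K * norm x + cmod c * (K' * norm x)"
      by (intro add_mono mult_left_mono K) simp
    finally show ?thesis by (simp add: algebra_simps)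
  qed
  then show ?thesis
    using assms unfolding bounded_functional_def
    by (intro conjI exI[of _ "K + cmod c * K'"]) (auto simp: algebra_simps)
qed

lemma bounded_functional_mult_left:
  assumes "bounded_functional L"
  shows "bounded_functional (\<lambda>x. L (x * d))"
proof -
  obtain K where K: "\<And>x. cmod (L x) \<le> K * norm x"
    using assms by (auto simp: bounded_functional_def)
  have "cmod (L (x * d)) \<le> (\<bar>K\<bar> * norm d) * norm x" for x
  proof -
    have "cmod (L (x * d)) \<le> \<bar>K\<bar> * norm (x * d)"
      using K[of "x * d"] by (meson abs_ge_self mult_right_mono norm_ge_zero order_trans)
    also have "\<dots> \<le> \<bar>K\<bar> * (norm x * norm d)"
      by (intro mult_left_mono norm_mult_ineq) simp
    finally show ?thesis by (simp add: algebra_simps)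
  qed
  then show ?thesis
    using assms unfolding bounded_functional_def
    by (auto simp: distrib_right mult_scaleC_left)
qed

lemma bounded_functional_mult_right:
  assumes "bounded_functional L"
  shows "bounded_functional (\<lambda>x. L (d * x))"
proof -
  obtain K where K: "\<And>x. cmod (L x) \<le> K * norm x"
    using assms by (auto simp: bounded_functional_def)
  have "cmod (L (d * x)) \<le> (\<bar>K\<bar> * norm d) * norm x" for x
  proof -
    have "cmod (L (d * x)) \<le> \<bar>K\<bar> * norm (d * x)"
      using K[of "d * x"] by (meson abs_ge_self mult_right_mono norm_ge_zero order_trans)
    also have "\<dots> \<le> \<bar>K\<bar> * (norm d * norm x)"
      by (intro mult_left_mono norm_mult_ineq) simp
    finally show ?thesis by (simp add: algebra_simps)
  qed
  then show ?thesis
    using assms unfolding bounded_functional_def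
    by (auto simp: distrib_left mult_scaleC_right)
qed

text \<open>The difference of the two sides is a bounded functional, so its kernel is a closed
  subspace. The constant \<open>c\<close> makes room for the scalar that appears when two words are
  exchanged.\<close>

lemma bounded_functionals_eq_on_closed_span:
  assumes "x \<in> closure (csubspace hull G)" "bounded_functional L" "bounded_functional M"
    and "\<And>g. g \<in> G \<Longrightarrow> L g = c * M g"
  shows "L x = c * M x"
proof -
  let ?D = "\<lambda>x. L x - c * M x"
  have D: "bounded_functional ?D"
    using assms(2,3) by (rule bounded_functional_lincomb)
  have "x \<in> {x. ?D x = 0}"
  proof (rule closed_span_induct[OF assms(1)])
    show "csubspace {x. ?D x = 0}"
      using assms(2,3) bounded_functional_zero[OF D] unfolding bounded_functional_def csubspace_def
      by (auto simp: algebra_simps)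
    show "closed {x. ?D x = 0}"
      by (intro closed_Collect_eq linear_continuous_on bounded_functional_bounded_linear D
          continuous_intros)
    show "G \<subseteq> {x. ?D x = 0}"
      using assms(4) by auto
  qed
  then show ?thesis by simp
qed

text \<open>Positivity at \<open>1 + e *\<^sub>C x\<close>, for a suitable phase \<open>e\<close>,
  bounds \<open>L x\<close> through \<open>L 1\<close> and \<open>L (star x * x)\<close>. No optimal
  constant is sought; the purpose is to obtain continuity of functionals known only to be linear and
  positive.\<close>

lemma positive_functional_bounded:
  fixes L :: "'b::cstar_algebra \<Rightarrow> complex"
  assumes add: "\<And>x y. L (x + y) = L x + L y" and scale: "\<And>c x. L (c *\<^sub>C x) = c * L x"
    and pos: "\<And>x. L (star x * x) \<in> \<real>\<^sub>\<ge>\<^sub>0"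
  shows "bounded_functional L"
proof -
  define M where "M = Re (L 1)"
  have pos': "0 \<le> Re (L (star x * x))" "Im (L (star x * x)) = 0" for x
    using pos[of x] by (auto simp: complex_nonneg_Reals_iff)
  have M: "0 \<le> M" using pos'(1)[of 1] by (simp add: M_def star_one)
  have diff: "L (x - y) = L x - L y" for x y
    using add[of "x - y" y] by simp
  text \<open>Since \<open>1 - x\<^sup>*x\<close> is a square, the functional is bounded by its value at 1 on
    positive elements of norm less than 1.\<close>
  have sq: "Re (L (star x * x)) \<le> M" if x: "norm x < 1" for x
  proof -
    have "(norm x)\<^sup>2 < 1" using x by (simp add: abs_square_less_1)
    then have "norm (star x * x) < 1" by (simp add: cstar_identity)
    moreover have "star (star x * x) = star x * x" by (simp add: star_mult star_star)
    ultimately obtain y where y: "star y = y" "1 - star x * x = y * y"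
      by (rule one_minus_selfadjoint_square)
    have "L 1 - L (star x * x) = L (star y * y)"
      using y by (simp flip: diff)
    then show ?thesis using pos'(1)[of y] by (metis M_def diff_ge_0_iff_ge minus_complex.simps(1))
  qed
  have bound1: "cmod (L x) \<le> 1 + M" if x: "norm x < 1" for x
  proof -
    \<comment> \<open>The phase \<open>e\<close> turns \<open>L x\<close> onto the negative real
      axis, so that the cross terms in the expansion contribute
      \<open>- 2 * cmod (L x)\<close>.\<close>
    obtain e where e: "cmod e = 1" "e * L x = - complex_of_real (cmod (L x))"
    proof (cases "L x = 0")
      case True then show ?thesis using that[of 1] by simp
    next
      case False
      show ?thesis
        by (rule that[of "- cnj (L x) / cmod (L x)"])
          (use False in \<open>simp_all add: norm_divide complex_norm_square[symmetric] power2_eq_square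
            mult.commute[of "cnj (L x)"]\<close>)
    qed
    have expand: "star (1 + c *\<^sub>C z) * (1 + c *\<^sub>C z) =
        1 + c *\<^sub>C z + (cnj c *\<^sub>C star z + (c * cnj c) *\<^sub>C (star z * z))" for c z
      by (simp add: star_add star_one distrib_left distrib_right star_scaleC mult_scaleC_left
          mult_scaleC_right scaleC_scaleC scaleC_add_right mult.commute)
    \<comment> \<open>The imaginary part of \<open>L\<close> at the square of
      \<open>1 + \<i> *\<^sub>C z\<close> is \<open>Re (L z) - Re (L (star z))\<close>, and it
      vanishes by positivity.\<close>
    have herm: "Re (L (star z)) = Re (L z)" for z
      using pos'(2)[of "1 + \<i> *\<^sub>C z"] pos'(2)[of 1] pos'(2)[of z]
      by (simp add: expand add scale star_one)
    let ?w = "1 + e *\<^sub>C x"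
    have "e * cnj e = 1"
      using e(1) by (metis complex_norm_square of_real_1 one_power2)
    then have w: "star ?w * ?w = 1 + e *\<^sub>C x + (star (e *\<^sub>C x) + star x * x)"
      by (simp add: expand star_scaleC scaleC_one)
    have "0 \<le> Re (L (star ?w * ?w))" by (rule pos')
    also have "\<dots> = M + 2 * Re (e * L x) + Re (L (star x * x))"
      unfolding w add plus_complex.simps herm by (simp add: scale M_def)
    also have "\<dots> = M - 2 * cmod (L x) + Re (L (star x * x))"
      by (simp add: e)
    finally show ?thesis using sq[OF x] M by linarith
  qed
  have "cmod (L x) \<le> (2 * (1 + M)) * norm x" for x
  proof (cases "x = 0")
    case True then show ?thesis using scale[of 0 0] by (simp add: scaleC_zero_left)
  next
    case False
    \<comment> \<open>Rescaling to norm 1/2 puts the vector inside the open unit ball, where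
      \<open>bound1\<close> applies.\<close>
    let ?r = "complex_of_real (1 / (2 * norm x))"
    have "cmod (L (?r *\<^sub>C x)) \<le> 1 + M"
      by (rule bound1) (use False in \<open>simp add: norm_scaleC norm_divide norm_mult\<close>)
    then show ?thesis using False
      by (simp add: scale norm_mult norm_divide field_simps)
  qed
  with add scale show ?thesis
    unfolding bounded_functional_def by blast
qed

section \<open>Hilbert modules with a finite orthonormal basis\<close>

locale hilbert_mod =
  fixes Y :: "('a::cstar_algebra, 'x::complex_vector) hbimod"
  assumes hilbert_module: "hilbert_module Y"
begin

lemma csubspace_hspace: "csubspace (hspace Y)"
  using hilbert_module by (simp add: hilbert_module_def)

lemma hspace_zero: "0 \<in> hspace Y"
  and hspace_add: "\<xi> \<in> hspace Y \<Longrightarrow> \<eta> \<in> hspace Y \<Longrightarrow> \<xi> + \<eta> \<in> hspace Y"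
  using csubspace_hspace by (simp_all add: csubspace_def)

lemma hspace_diff: "\<xi> \<in> hspace Y \<Longrightarrow> \<eta> \<in> hspace Y \<Longrightarrow> \<xi> - \<eta> \<in> hspace Y"
  using hspace_add[of \<xi> "- \<eta>"] csubspace_uminus[OF csubspace_hspace, of \<eta>] by simp

lemmas hspace_sum = csubspace_sum[OF csubspace_hspace]

lemma ract_in: "\<xi> \<in> hspace Y \<Longrightarrow> ract Y \<xi> a \<in> hspace Y"
  and ract_add_right: "\<xi> \<in> hspace Y \<Longrightarrow> ract Y \<xi> (a + b) = ract Y \<xi> a + ract Y \<xi> b"
  and ract_one: "\<xi> \<in> hspace Y \<Longrightarrow> ract Y \<xi> 1 = \<xi>"
  and hip_add_right: "\<xi> \<in> hspace Y \<Longrightarrow> \<eta> \<in> hspace Y \<Longrightarrow> \<zeta> \<in> hspace Y \<Longrightarrow>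
    hip Y \<xi> (\<eta> + \<zeta>) = hip Y \<xi> \<eta> + hip Y \<xi> \<zeta>"
  and hip_ract_right: "\<xi> \<in> hspace Y \<Longrightarrow> \<eta> \<in> hspace Y \<Longrightarrow> hip Y \<xi> (ract Y \<eta> a) = hip Y \<xi> \<eta> * a"
  and star_hip: "\<xi> \<in> hspace Y \<Longrightarrow> \<eta> \<in> hspace Y \<Longrightarrow> star (hip Y \<xi> \<eta>) = hip Y \<eta> \<xi>"
  and hip_definite: "\<xi> \<in> hspace Y \<Longrightarrow> hip Y \<xi> \<xi> = 0 \<Longrightarrow> \<xi> = 0"
  using hilbert_module by (simp_all add: hilbert_module_def)

lemma ract_zero_right: "\<xi> \<in> hspace Y \<Longrightarrow> ract Y \<xi> 0 = 0"
  using ract_add_right[of \<xi> 0 0] by simp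

lemma hip_zero_right: "\<xi> \<in> hspace Y \<Longrightarrow> hip Y \<xi> 0 = 0"
  using hip_add_right[of \<xi> 0 0] by (simp add: hspace_zero)

lemma hip_diff_right: "\<xi> \<in> hspace Y \<Longrightarrow> \<eta> \<in> hspace Y \<Longrightarrow> \<zeta> \<in> hspace Y \<Longrightarrow>
    hip Y \<xi> (\<eta> - \<zeta>) = hip Y \<xi> \<eta> - hip Y \<xi> \<zeta>"
  using hip_add_right[of \<xi> "\<eta> - \<zeta>" \<zeta>] by (simp add: hspace_diff)

lemma hip_ract_left: "\<xi> \<in> hspace Y \<Longrightarrow> \<eta> \<in> hspace Y \<Longrightarrow>
    hip Y (ract Y \<xi> a) \<eta> = star a * hip Y \<xi> \<eta>"
  using arg_cong[OF hip_ract_right[of \<eta> \<xi> a], of star] by (simp add: star_mult star_hip ract_in)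

lemma hip_sum_right:
  "\<xi> \<in> hspace Y \<Longrightarrow> (\<And>k. k \<in> A \<Longrightarrow> f k \<in> hspace Y) \<Longrightarrow>
    hip Y \<xi> (sum f A) = (\<Sum>k\<in>A. hip Y \<xi> (f k))"
  by (induction A rule: infinite_finite_induct) (simp_all add: hip_zero_right hip_add_right hspace_sum)

lemma hip_sum_left:
  "\<xi> \<in> hspace Y \<Longrightarrow> (\<And>k. k \<in> A \<Longrightarrow> f k \<in> hspace Y) \<Longrightarrow>
    hip Y (sum f A) \<xi> = (\<Sum>k\<in>A. hip Y (f k) \<xi>)"
  using arg_cong[OF hip_sum_right[of \<xi> A f], of star]
  by (simp add: star_sum star_hip hspace_sum)

text \<open>Testing against the difference of the two vectors reduces the claim to definiteness of
  the inner product.\<close>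

lemma hip_eqI:
  assumes "\<xi> \<in> hspace Y" "\<eta> \<in> hspace Y"
    and "\<And>\<zeta>. \<zeta> \<in> hspace Y \<Longrightarrow> hip Y \<zeta> \<xi> = hip Y \<zeta> \<eta>"
  shows "\<xi> = \<eta>"
  using hip_definite[of "\<xi> - \<eta>"] assms by (simp add: hspace_diff hip_diff_right)

section \<open>Adjointable and compact operators\<close>

lemma is_adjoint_sym: "is_adjoint Y S T \<Longrightarrow> is_adjoint Y T S"
  unfolding is_adjoint_def by (metis star_hip)

text \<open>This justifies the description operator in the involution of
  \<open>adjointables\<close>. Off the module both adjoints vanish by the encoding of
  operators.\<close>

lemma is_adjoint_unique:
  assumes "is_adjoint Y S T" "is_adjoint Y S T'"
  shows "T = T'"
proof
  fix \<xi>
  show "T \<xi> = T' \<xi>"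
    using assms by (cases "\<xi> \<in> hspace Y") (auto simp: is_adjoint_def intro!: hip_eqI)
qed

lemma cinvol_adjointables: "is_adjoint Y S T \<Longrightarrow> cinvol (adjointables Y) S = T"
  using is_adjoint_unique unfolding adjointables_def by (simp add: the_equality)

lemma adjointables_in: "S \<in> carr (adjointables Y) \<Longrightarrow> \<xi> \<in> hspace Y \<Longrightarrow> S \<xi> \<in> hspace Y"
  and adjointables_off: "S \<in> carr (adjointables Y) \<Longrightarrow> \<xi> \<notin> hspace Y \<Longrightarrow> S \<xi> = 0"
  by (auto simp: adjointables_def is_adjoint_def)

text \<open>The encoding of operators does not ask for linearity; it follows by moving
  \<open>S\<close> to the other side of the inner product, where it becomes its adjoint
  \<open>T\<close>. The same argument gives right linearity below.\<close>

lemma adjointables_add: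
  assumes S: "S \<in> carr (adjointables Y)" and "\<xi> \<in> hspace Y" "\<eta> \<in> hspace Y"
  shows "S (\<xi> + \<eta>) = S \<xi> + S \<eta>"
proof -
  obtain T where "is_adjoint Y T S" "is_adjoint Y S T"
    using S is_adjoint_sym by (auto simp: adjointables_def)
  then have T: "\<And>\<zeta> \<xi>. \<zeta> \<in> hspace Y \<Longrightarrow> \<xi> \<in> hspace Y \<Longrightarrow> hip Y \<zeta> (S \<xi>) = hip Y (T \<zeta>) \<xi>"
    "\<And>\<zeta>. \<zeta> \<in> hspace Y \<Longrightarrow> T \<zeta> \<in> hspace Y" "\<And>\<zeta>. \<zeta> \<in> hspace Y \<Longrightarrow> S \<zeta> \<in> hspace Y"
    by (auto simp: is_adjoint_def)
  show ?thesis
    using assms by (intro hip_eqI) (simp_all add: T hspace_add hip_add_right)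
qed

lemma adjointables_ract:
  assumes S: "S \<in> carr (adjointables Y)" and "\<xi> \<in> hspace Y"
  shows "S (ract Y \<xi> a) = ract Y (S \<xi>) a"
proof -
  obtain T where "is_adjoint Y T S" "is_adjoint Y S T"
    using S is_adjoint_sym by (auto simp: adjointables_def)
  then have T: "\<And>\<zeta> \<xi>. \<zeta> \<in> hspace Y \<Longrightarrow> \<xi> \<in> hspace Y \<Longrightarrow> hip Y \<zeta> (S \<xi>) = hip Y (T \<zeta>) \<xi>"
    "\<And>\<zeta>. \<zeta> \<in> hspace Y \<Longrightarrow> T \<zeta> \<in> hspace Y" "\<And>\<zeta>. \<zeta> \<in> hspace Y \<Longrightarrow> S \<zeta> \<in> hspace Y"
    by (auto simp: is_adjoint_def)
  show ?thesis
    using assms by (intro hip_eqI) (simp_all add: T ract_in hip_ract_right)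
qed

lemma adjointables_zero: "S \<in> carr (adjointables Y) \<Longrightarrow> S 0 = 0"
  using adjointables_add[of S 0 0] by (simp add: hspace_zero)

lemma adjointables_sum:
  "S \<in> carr (adjointables Y) \<Longrightarrow> (\<And>k. k \<in> A \<Longrightarrow> f k \<in> hspace Y) \<Longrightarrow>
    S (sum f A) = (\<Sum>k\<in>A. S (f k))"
  by (induction A rule: infinite_finite_induct)
    (simp_all add: adjointables_zero adjointables_add hspace_sum)

text \<open>A finite sum of rank-one operators approximates itself with error zero. The supremum
  defining \<open>op_norm\<close> ranges over a non-empty set, since it contains the zero
  vector.\<close>

lemma compactsI:
  assumes "S \<in> carr (adjointables Y)" "S \<in> theta_span Y"
  shows "S \<in> carr (compacts Y)"
proof -
  have "op_norm Y (\<lambda>_. 0) = 0"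
  proof -
    have "{\<xi> \<in> hspace Y. hnorm Y \<xi> \<le> 1} \<noteq> {}"
      using hspace_zero hip_zero_right by (auto simp: hnorm_def intro!: exI[of _ 0])
    then show ?thesis
      by (simp add: op_norm_def hnorm_def hip_zero_right hspace_zero)
  qed
  then show ?thesis
    using assms by (auto simp: compacts_def intro!: bexI[of _ S])
qed


end

locale hilbert_bimod = hilbert_mod +
  assumes star_hom_left: "star_hom type_alg (adjointables Y) (left_op Y)"
begin

lemma left_op_adjointable: "left_op Y a \<in> carr (adjointables Y)"
  using star_hom_left by (simp add: star_hom_def type_alg_def)

lemma is_adjoint_left_op: "is_adjoint Y (left_op Y a) (left_op Y (star a))"
proof -
  obtain T where T: "is_adjoint Y (left_op Y a) T"
    using left_op_adjointable[of a] by (auto simp: adjointables_def)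
  have "left_op Y (star a) = cinvol (adjointables Y) (left_op Y a)"
    using star_hom_left by (simp add: star_hom_def type_alg_def)
  with T show ?thesis by (simp add: cinvol_adjointables)
qed

lemma lact_in: "\<xi> \<in> hspace Y \<Longrightarrow> lact Y a \<xi> \<in> hspace Y"
  using adjointables_in[OF left_op_adjointable, of \<xi> a] by (simp add: left_op_def)

lemma lact_add_right: "\<xi> \<in> hspace Y \<Longrightarrow> \<eta> \<in> hspace Y \<Longrightarrow> lact Y a (\<xi> + \<eta>) = lact Y a \<xi> + lact Y a \<eta>"
  using adjointables_add[OF left_op_adjointable, of \<xi> \<eta> a] by (simp add: left_op_def hspace_add)

lemma lact_sum_right:
  "(\<And>k. k \<in> A \<Longrightarrow> f k \<in> hspace Y) \<Longrightarrow> lact Y a (sum f A) = (\<Sum>k\<in>A. lact Y a (f k))"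
  using adjointables_sum[OF left_op_adjointable, of A f a] by (simp add: left_op_def hspace_sum)

lemma hip_lact_left: "\<xi> \<in> hspace Y \<Longrightarrow> \<eta> \<in> hspace Y \<Longrightarrow>
    hip Y (lact Y a \<xi>) \<eta> = hip Y \<xi> (lact Y (star a) \<eta>)"
  using is_adjoint_left_op[of a] by (simp add: is_adjoint_def left_op_def)

lemma lact_lact: "\<xi> \<in> hspace Y \<Longrightarrow> lact Y a (lact Y b \<xi>) = lact Y (a * b) \<xi>"
proof -
  assume \<xi>: "\<xi> \<in> hspace Y"
  have "left_op Y (a * b) = left_op Y a \<circ> left_op Y b"
    using star_hom_left by (simp add: star_hom_def type_alg_def adjointables_def)
  from fun_cong[OF this, of \<xi>] \<xi> show ?thesis by (simp add: left_op_def lact_in)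
qed

end

locale orthonormal_basis = hilbert_mod Y
  for Y :: "('a::cstar_algebra, 'x::complex_vector) hbimod" +
  fixes d :: nat and e :: "nat \<Rightarrow> 'x"
  assumes basis_in: "j < d \<Longrightarrow> e j \<in> hspace Y"
    and hip_basis: "j < d \<Longrightarrow> k < d \<Longrightarrow> hip Y (e j) (e k) = (if j = k then 1 else 0)"
    and basis_span: "hspace Y = {\<Sum>j<d. ract Y (e j) (b j) | b. True}"
begin

lemma basis_expansion:
  assumes "\<xi> \<in> hspace Y"
  shows "\<xi> = (\<Sum>j<d. ract Y (e j) (hip Y (e j) \<xi>))"
proof -
  obtain b where b: "\<xi> = (\<Sum>j<d. ract Y (e j) (b j))"
    using assms basis_span by blast
  have "hip Y (e j) \<xi> = b j" if "j < d" for j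
  proof -
    have "hip Y (e j) \<xi> = (\<Sum>k<d. hip Y (e j) (ract Y (e k) (b k)))"
      unfolding b by (rule hip_sum_right) (use that basis_in ract_in in auto)
    also have "\<dots> = (\<Sum>k<d. if j = k then b k else 0)"
      using that by (intro sum.cong) (auto simp: basis_in hip_ract_right hip_basis)
    finally show ?thesis using that by simp
  qed
  then show ?thesis using b by simp
qed

text \<open>The orthogonal projection onto the right submodule generated by the basis vectors with
  index in \<open>J\<close>, that is, the sum of the operators
  \<open>theta Y (e j) (e j)\<close>.\<close>

definition basis_proj :: "nat set \<Rightarrow> 'x \<Rightarrow> 'x" where
  "basis_proj J \<zeta> = (if \<zeta> \<in> hspace Y then \<Sum>j\<in>J. ract Y (e j) (hip Y (e j) \<zeta>) else 0)"

lemma basis_proj_in: "J \<subseteq> {..<d} \<Longrightarrow> basis_proj J \<zeta> \<in> hspace Y"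
  by (auto simp: basis_proj_def hspace_zero intro!: hspace_sum ract_in basis_in)

lemma basis_proj_singleton: "basis_proj {j} = theta Y (e j) (e j)"
  by (auto simp: basis_proj_def theta_def)

lemma is_adjoint_basis_proj:
  assumes "J \<subseteq> {..<d}"
  shows "is_adjoint Y (basis_proj J) (basis_proj J)"
proof -
  have J: "\<And>j. j \<in> J \<Longrightarrow> j < d" using assms by auto
  show ?thesis
    unfolding is_adjoint_def
    by (auto simp: basis_proj_in[OF assms])
      (auto simp: basis_proj_def hip_sum_left hip_sum_right J basis_in ract_in hip_ract_left
        hip_ract_right star_hip)
qed

lemma basis_proj_adjointable: "J \<subseteq> {..<d} \<Longrightarrow> basis_proj J \<in> carr (adjointables Y)"
  using is_adjoint_basis_proj by (auto simp: adjointables_def)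

lemma basis_proj_compact:
  assumes "J \<subseteq> {..<d}"
  shows "basis_proj J \<in> carr (compacts Y)"
proof (rule compactsI)
  show "basis_proj J \<in> carr (adjointables Y)"
    by (rule basis_proj_adjointable[OF assms])
  have "finite J" using assms finite_subset by blast
  \<comment> \<open>Elements of \<open>theta_span\<close> are sums over initial segments of the
    naturals, so \<open>J\<close> has to be enumerated.\<close>
  then obtain h where h: "bij_betw h {..<card J} J"
    using ex_bij_betw_nat_finite atLeast0LessThan by metis
  then have mem: "h k \<in> J" if "k < card J" for k
    using that by (auto simp: bij_betw_def)
  have "basis_proj J = (\<lambda>\<zeta>. \<Sum>k<card J. theta Y (e (h k)) (e (h k)) \<zeta>)"
    using sum.reindex_bij_betw[OF h, symmetric] by (auto simp: basis_proj_def theta_def fun_eq_iff)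
  moreover have "\<forall>k<card J. e (h k) \<in> hspace Y"
    using mem assms basis_in by auto
  ultimately show "basis_proj J \<in> theta_span Y"
    unfolding theta_span_def
    by (intro CollectI exI[of _ "card J"] exI[of _ "\<lambda>k. e (h k)"]) simp
qed

text \<open>Orthonormality kills the mixed terms. This is where products of compact operators become
  intersections of index sets.\<close>

lemma basis_proj_comp:
  assumes "J \<subseteq> {..<d}" "K \<subseteq> {..<d}"
  shows "basis_proj J \<circ> basis_proj K = basis_proj (J \<inter> K)"
proof
  fix \<zeta>
  have J: "\<And>j. j \<in> J \<Longrightarrow> j < d" "\<And>j. j \<in> K \<Longrightarrow> j < d" "finite J" "finite K"
    using assms finite_subset by auto
  show "(basis_proj J \<circ> basis_proj K) \<zeta> = basis_proj (J \<inter> K) \<zeta>"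
  proof (cases "\<zeta> \<in> hspace Y")
    case True
    have "hip Y (e j) (basis_proj K \<zeta>) = (if j \<in> K then hip Y (e j) \<zeta> else 0)" if "j \<in> J" for j
    proof -
      have "hip Y (e j) (basis_proj K \<zeta>) = (\<Sum>k\<in>K. (if j = k then 1 else 0) * hip Y (e k) \<zeta>)"
        using True that unfolding basis_proj_def
        by (simp add: hip_sum_right J basis_in ract_in hip_ract_right hip_basis)
      also have "\<dots> = (\<Sum>k\<in>K. if j = k then hip Y (e k) \<zeta> else 0)"
        by (intro sum.cong) auto
      finally show ?thesis using J by simp
    qed
    then have "(basis_proj J \<circ> basis_proj K) \<zeta> =
        (\<Sum>j\<in>J. if j \<in> K then ract Y (e j) (hip Y (e j) \<zeta>) else 0)"
      using basis_proj_in[OF assms(2), of \<zeta>] J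
      by (auto simp: basis_proj_def[of J] basis_in ract_zero_right intro!: sum.cong)
    also have "\<dots> = (\<Sum>j\<in>J \<inter> K. ract Y (e j) (hip Y (e j) \<zeta>))"
      using J by (simp add: sum.inter_restrict)
    finally show ?thesis using True by (simp add: basis_proj_def)
  next
    case False
    then show ?thesis
      using adjointables_zero[OF basis_proj_adjointable[OF assms(1)]] by (simp add: basis_proj_def)
  qed
qed

end

section \<open>Product systems of finite type\<close>

locale finite_type_system =
  fixes X :: "('g::lattice_ab_group_add, 'a::cstar_algebra, 'x::complex_vector) prodsys"
    and n :: "'g \<Rightarrow> nat"
    and u :: "'g \<Rightarrow> nat \<Rightarrow> 'x"
    and m :: "'g \<Rightarrow> 'g \<Rightarrow> nat \<Rightarrow> nat \<Rightarrow> nat"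
  assumes product_system: "product_system X"
    and associative_system: "associative_system X"
    and finite_type: "finite_type X n u m"
    and bijective_maps: "bijective_maps n m"
begin

lemma hilbert_bimod: "0 \<le> s \<Longrightarrow> hilbert_bimod (fib X s)"
  using product_system
  by (simp add: product_system_def hilbert_bimodule_def hilbert_bimod_def hilbert_mod_def
      hilbert_bimod_axioms_def)

lemma hilbert_mod: "0 \<le> s \<Longrightarrow> hilbert_mod (fib X s)"
  by (rule hilbert_bimod.axioms(1)[OF hilbert_bimod])

lemma orthonormal_basis: "0 \<le> s \<Longrightarrow> orthonormal_basis (fib X s) (n s) (u s)"
  using finite_type hilbert_mod[of s]
  unfolding finite_type_def orthonormal_basis_def orthonormal_basis_axioms_def by blast

lemma left_span: "0 \<le> s \<Longrightarrow> fsp X s = {\<Sum>j<n s. lact (fib X s) (a j) (u s j) | a. True}"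
  using finite_type unfolding finite_type_def by blast

lemma unit_fibre: "unit_fibre X"
  and pmul_in: "0 \<le> s \<Longrightarrow> 0 \<le> r \<Longrightarrow> \<xi> \<in> fsp X s \<Longrightarrow> \<eta> \<in> fsp X r \<Longrightarrow> pmul X s r \<xi> \<eta> \<in> fsp X (s + r)"
  and pmul_0_left: "0 \<le> s \<Longrightarrow> \<xi> \<in> fsp X s \<Longrightarrow> pmul X 0 s (emb X a) \<xi> = lact (fib X s) a \<xi>"
  and pmul_0_right: "0 \<le> s \<Longrightarrow> \<xi> \<in> fsp X s \<Longrightarrow> pmul X s 0 \<xi> (emb X a) = ract (fib X s) \<xi> a"
  using product_system by (simp_all add: product_system_def)

lemma emb_in: "emb X a \<in> fsp X 0"
  and emb_surj: "\<xi> \<in> fsp X 0 \<Longrightarrow> \<exists>a. \<xi> = emb X a"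
  and inv_emb: "inv (emb X) (emb X a) = a"
  and emb_add: "emb X (a + b) = emb X a + emb X b"
  and hip_emb: "hip (fib X 0) (emb X a) (emb X b) = star a * b"
  and lact_emb: "lact (fib X 0) a (emb X b) = emb X (a * b)"
  and ract_emb: "ract (fib X 0) (emb X a) b = emb X (a * b)"
  using unit_fibre by (auto simp: unit_fibre_def bij_betw_def)

lemma pmul_assoc:
  "0 \<le> s \<Longrightarrow> 0 \<le> r \<Longrightarrow> 0 \<le> q \<Longrightarrow> \<xi> \<in> fsp X s \<Longrightarrow> \<eta> \<in> fsp X r \<Longrightarrow> \<zeta> \<in> fsp X q \<Longrightarrow>
    pmul X (s + r) q (pmul X s r \<xi> \<eta>) \<zeta> = pmul X s (r + q) \<xi> (pmul X r q \<eta> \<zeta>)"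
  using associative_system by (simp add: associative_system_def)

text \<open>Associativity with the element \<open>emb X a\<close> of the unit fibre as middle
  factor; it is the balancing relation of the tensor product, valid also when an index is 0.\<close>

lemma pmul_ract_left:
  "0 \<le> s \<Longrightarrow> 0 \<le> r \<Longrightarrow> \<xi> \<in> fsp X s \<Longrightarrow> \<eta> \<in> fsp X r \<Longrightarrow>
    pmul X s r (ract (fib X s) \<xi> a) \<eta> = pmul X s r \<xi> (lact (fib X r) a \<eta>)"
  using pmul_assoc[of s 0 r \<xi> "emb X a" \<eta>] by (simp add: emb_in pmul_0_left pmul_0_right)

lemma pmul_ract_right:
  "0 \<le> s \<Longrightarrow> 0 \<le> r \<Longrightarrow> \<xi> \<in> fsp X s \<Longrightarrow> \<eta> \<in> fsp X r \<Longrightarrow>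
    pmul X s r \<xi> (ract (fib X r) \<eta> a) = ract (fib X (s + r)) (pmul X s r \<xi> \<eta>) a"
  using pmul_assoc[of s r 0 \<xi> \<eta> "emb X a"] by (simp add: emb_in pmul_0_right pmul_in)

lemma basis_in: "0 \<le> s \<Longrightarrow> j < n s \<Longrightarrow> u s j \<in> fsp X s"
  by (rule orthonormal_basis.basis_in[OF orthonormal_basis])

lemma hip_basis:
  "0 \<le> s \<Longrightarrow> j < n s \<Longrightarrow> k < n s \<Longrightarrow> hip (fib X s) (u s j) (u s k) = (if j = k then 1 else 0)"
  by (rule orthonormal_basis.hip_basis[OF orthonormal_basis])

lemma basis_expansion:
  "0 \<le> s \<Longrightarrow> \<xi> \<in> fsp X s \<Longrightarrow>
    \<xi> = (\<Sum>j<n s. ract (fib X s) (u s j) (hip (fib X s) (u s j) \<xi>))"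
  by (rule orthonormal_basis.basis_expansion[OF orthonormal_basis])

lemma index_map_less: "0 \<le> s \<Longrightarrow> 0 \<le> r \<Longrightarrow> j < n s \<Longrightarrow> k < n r \<Longrightarrow> m s r j k < n (s + r)"
  and pmul_basis: "0 \<le> s \<Longrightarrow> 0 \<le> r \<Longrightarrow> j < n s \<Longrightarrow> k < n r \<Longrightarrow>
    pmul X s r (u s j) (u r k) = u (s + r) (m s r j k)"
  using finite_type by (simp_all add: finite_type_def)

text \<open>Every basis vector over \<open>s + r\<close> factors into basis vectors over
  \<open>s\<close> and \<open>r\<close>; this is how a word is later divided by a common part of two
  indices.\<close>

lemma index_map_surj:
  assumes "0 \<le> s" "0 \<le> r" "j < n (s + r)"
  obtains k l where "k < n s" "l < n r" "j = m s r k l"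
proof -
  have "j \<in> (\<lambda>(k, l). m s r k l) ` ({..<n s} \<times> {..<n r})"
    using assms bijective_maps by (auto simp: bijective_maps_def bij_betw_def)
  then show thesis using that by auto
qed

lemma index_map_inj:
  assumes "0 \<le> s" "0 \<le> r" "k < n s" "k' < n s" "l < n r" "l' < n r" "m s r k l = m s r k' l'"
  shows "k = k'" "l = l'"
proof -
  have "inj_on (\<lambda>(k, l). m s r k l) ({..<n s} \<times> {..<n r})"
    using assms bijective_maps by (auto simp: bijective_maps_def bij_betw_def)
  from inj_onD[OF this, of "(k, l)" "(k', l')"] assms show "k = k'" "l = l'" by auto
qed

text \<open>Elements of the form \<open>lact (fib X s) a (u s j)\<close> are fixed by the unit, and
  by the left spanning condition of finite type their sums exhaust the fibre.\<close>

lemma lact_one: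
  assumes s: "0 \<le> s" and \<xi>: "\<xi> \<in> fsp X s"
  shows "lact (fib X s) 1 \<xi> = \<xi>"
proof -
  interpret hilbert_bimod "fib X s" by (rule hilbert_bimod[OF s])
  obtain a where "\<xi> = (\<Sum>j<n s. lact (fib X s) (a j) (u s j))"
    using \<xi> left_span[OF s] by blast
  then show ?thesis
    using basis_in[OF s] by (simp, subst lact_sum_right) (simp_all add: lact_in lact_lact)
qed

lemma tensor_factorization:
  assumes "0 \<le> s" "0 \<le> r" "s \<noteq> 0" "r \<noteq> 0"
  obtains W t F where "balanced_tensor (fib X s) (fib X r) W t" "bimodule_iso W (fib X (s + r)) F"
    "\<And>\<xi> \<eta>. \<xi> \<in> fsp X s \<Longrightarrow> \<eta> \<in> fsp X r \<Longrightarrow> F (t \<xi> \<eta>) = pmul X s r \<xi> \<eta>"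
proof -
  have "\<exists>W t F. balanced_tensor (fib X s) (fib X r) W t \<and> bimodule_iso W (fib X (s + r)) F \<and>
      (\<forall>\<xi>\<in>fsp X s. \<forall>\<eta>\<in>fsp X r. F (t \<xi> \<eta>) = pmul X s r \<xi> \<eta>)"
    using product_system assms by (simp add: product_system_def)
  then show thesis using that by (elim exE conjE) simp
qed

text \<open>A tensor product model is available only when both indices are nonzero; when one of them
  is 0 the product is a bimodule action. The same case split recurs below.\<close>

lemma pmul_add_right:
  assumes s: "0 \<le> s" and r: "0 \<le> r" and \<xi>: "\<xi> \<in> fsp X s" and \<eta>: "\<eta> \<in> fsp X r" "\<eta>' \<in> fsp X r"
  shows "pmul X s r \<xi> (\<eta> + \<eta>') = pmul X s r \<xi> \<eta> + pmul X s r \<xi> \<eta>'"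
proof -
  interpret r: hilbert_bimod "fib X r" by (rule hilbert_bimod[OF r])
  consider "s = 0" | "r = 0" | "s \<noteq> 0" "r \<noteq> 0" by blast
  then show ?thesis
  proof cases
    case 1
    then obtain a where "\<xi> = emb X a" using \<xi> emb_surj by blast
    with 1 r \<eta> show ?thesis by (simp add: pmul_0_left r.hspace_add r.lact_add_right)
  next
    case 2
    then obtain a b where "\<eta> = emb X a" "\<eta>' = emb X b" using \<eta> emb_surj by metis
    with 2 s \<xi> show ?thesis
      using hilbert_mod.ract_add_right[OF hilbert_mod[OF s]]
      by (simp add: pmul_0_right flip: emb_add)
  next
    case 3
    obtain W t F where W: "balanced_tensor (fib X s) (fib X r) W t" "bimodule_iso W (fib X (s + r)) F"
      and F: "\<And>\<xi> \<eta>. \<xi> \<in> fsp X s \<Longrightarrow> \<eta> \<in> fsp X r \<Longrightarrow> F (t \<xi> \<eta>) = pmul X s r \<xi> \<eta>"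
      using tensor_factorization[OF s r 3] by metis
    have "t \<xi> (\<eta> + \<eta>') = t \<xi> \<eta> + t \<xi> \<eta>'" "t \<xi> \<eta> \<in> hspace W" "t \<xi> \<eta>' \<in> hspace W"
      using W(1) \<xi> \<eta> by (simp_all add: balanced_tensor_def)
    then have "F (t \<xi> (\<eta> + \<eta>')) = F (t \<xi> \<eta>) + F (t \<xi> \<eta>')"
      using W(2) by (simp add: bimodule_iso_def)
    with \<xi> \<eta> show ?thesis by (simp add: F r.hspace_add)
  qed
qed

lemma pmul_zero_right: "0 \<le> s \<Longrightarrow> 0 \<le> r \<Longrightarrow> \<xi> \<in> fsp X s \<Longrightarrow> pmul X s r \<xi> 0 = 0"
  using pmul_add_right[of s r \<xi> 0 0] hilbert_mod.hspace_zero[OF hilbert_mod] by simp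

lemma pmul_sum_right:
  assumes "0 \<le> s" "0 \<le> r" "\<xi> \<in> fsp X s" "\<And>k. k \<in> A \<Longrightarrow> f k \<in> fsp X r"
  shows "pmul X s r \<xi> (sum f A) = (\<Sum>k\<in>A. pmul X s r \<xi> (f k))"
  using assms(4)
  by (induction A rule: infinite_finite_induct)
    (simp_all add: assms(1-3) pmul_zero_right pmul_add_right
      hilbert_mod.hspace_sum[OF hilbert_mod[OF assms(2)]])

text \<open>The isomorphism \<open>F\<close> transports the inner product of the tensor product; the
  coefficient is then moved to the second variable by adjointness of the left action.\<close>

lemma hip_pmul:
  assumes s: "0 \<le> s" and r: "0 \<le> r"
    and \<xi>: "\<xi> \<in> fsp X s" "\<xi>' \<in> fsp X s" and \<eta>: "\<eta> \<in> fsp X r" "\<eta>' \<in> fsp X r"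
  shows "hip (fib X (s + r)) (pmul X s r \<xi> \<eta>) (pmul X s r \<xi>' \<eta>') =
    hip (fib X r) \<eta> (lact (fib X r) (hip (fib X s) \<xi> \<xi>') \<eta>')"
proof -
  interpret s: hilbert_bimod "fib X s" by (rule hilbert_bimod[OF s])
  interpret r: hilbert_bimod "fib X r" by (rule hilbert_bimod[OF r])
  consider "s = 0" | "r = 0" | "s \<noteq> 0" "r \<noteq> 0" by blast
  then show ?thesis
  proof cases
    case 1
    then obtain a b where "\<xi> = emb X a" "\<xi>' = emb X b" using \<xi> emb_surj by metis
    with 1 r \<eta> show ?thesis
      by (simp add: pmul_0_left hip_emb r.hip_lact_left r.lact_in r.lact_lact)
  next
    case 2
    then obtain a b where "\<eta> = emb X a" "\<eta>' = emb X b" using \<eta> emb_surj by metis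
    with 2 s \<xi> show ?thesis
      by (simp add: pmul_0_right hip_emb lact_emb s.hip_ract_left s.hip_ract_right s.ract_in
          mult.assoc)
  next
    case 3
    obtain W t F where W: "balanced_tensor (fib X s) (fib X r) W t" "bimodule_iso W (fib X (s + r)) F"
      and F: "\<And>\<xi> \<eta>. \<xi> \<in> fsp X s \<Longrightarrow> \<eta> \<in> fsp X r \<Longrightarrow> F (t \<xi> \<eta>) = pmul X s r \<xi> \<eta>"
      using tensor_factorization[OF s r 3] by metis
    have "hip W (t \<xi> \<eta>) (t \<xi>' \<eta>') = hip (fib X r) (lact (fib X r) (hip (fib X s) \<xi>' \<xi>) \<eta>) \<eta>'"
      and "t \<xi> \<eta> \<in> hspace W" "t \<xi>' \<eta>' \<in> hspace W"
      using W(1) \<xi> \<eta> by (simp_all add: balanced_tensor_def)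
    then show ?thesis
      using W(2) \<xi> \<eta>
      by (simp add: bimodule_iso_def r.hip_lact_left s.star_hip flip: F)
  qed
qed

section \<open>Amplified operators and basis projections\<close>

abbreviation basis_proj :: "'g \<Rightarrow> nat set \<Rightarrow> 'x \<Rightarrow> 'x" where
  "basis_proj s \<equiv> orthonormal_basis.basis_proj (fib X s) (u s)"

text \<open>By surjectivity of the index map every basis vector over \<open>s + r\<close> is a
  product, and right linear operators are determined by a right basis. This gives the uniqueness
  behind the definition of \<open>amplify\<close>.\<close>

lemma adjointables_eqI:
  assumes s: "0 \<le> s" and r: "0 \<le> r"
    and S: "S \<in> carr (adjointables (fib X (s + r)))" and T: "T \<in> carr (adjointables (fib X (s + r)))"
    and eq: "\<And>\<xi> \<eta>. \<xi> \<in> fsp X s \<Longrightarrow> \<eta> \<in> fsp X r \<Longrightarrow> S (pmul X s r \<xi> \<eta>) = T (pmul X s r \<xi> \<eta>)"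
  shows "S = T"
proof
  fix \<zeta>
  have sr: "0 \<le> s + r" using s r by simp
  interpret sr: hilbert_bimod "fib X (s + r)" by (rule hilbert_bimod[OF sr])
  show "S \<zeta> = T \<zeta>"
  proof (cases "\<zeta> \<in> fsp X (s + r)")
    case True
    have "S (u (s + r) j) = T (u (s + r) j)" if "j < n (s + r)" for j
    proof -
      obtain k l where "k < n s" "l < n r" "j = m s r k l"
        by (rule index_map_surj[OF s r \<open>j < n (s + r)\<close>])
      then show ?thesis
        using eq[OF basis_in[OF s, of k] basis_in[OF r, of l]] by (simp add: pmul_basis[OF s r])
    qed
    then have sum_eq: "(\<Sum>j<n (s + r). S (ract (fib X (s + r)) (u (s + r) j) (b j))) =
        (\<Sum>j<n (s + r). T (ract (fib X (s + r)) (u (s + r) j) (b j)))" for b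
      by (intro sum.cong)
        (auto simp: basis_in[OF sr] sr.adjointables_ract[OF S] sr.adjointables_ract[OF T])
    have expand: "R \<zeta> = (\<Sum>j<n (s + r). R (ract (fib X (s + r)) (u (s + r) j)
        (hip (fib X (s + r)) (u (s + r) j) \<zeta>)))" if "R \<in> carr (adjointables (fib X (s + r)))" for R
      by (subst basis_expansion[OF sr True], rule sr.adjointables_sum[OF that])
        (simp add: sr.ract_in basis_in[OF sr])
    show ?thesis
      by (rule trans[OF expand[OF S] trans[OF sum_eq expand[OF T, symmetric]]])
  qed (simp add: sr.adjointables_off[OF S] sr.adjointables_off[OF T])
qed

text \<open>All three branches of the definition of \<open>amplify\<close> are governed by the same
  rule on products, so the later computation needs no case split.\<close>

lemma amplify_eqI:
  assumes s: "0 \<le> s" and r: "0 \<le> r"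
    and S: "S \<in> carr (adjointables (fib X s))" and T: "T \<in> carr (adjointables (fib X (s + r)))"
    and eq: "\<And>\<xi> \<eta>. \<xi> \<in> fsp X s \<Longrightarrow> \<eta> \<in> fsp X r \<Longrightarrow> T (pmul X s r \<xi> \<eta>) = pmul X s r (S \<xi>) \<eta>"
  shows "amplify X s r S = T"
proof -
  interpret s: hilbert_bimod "fib X s" by (rule hilbert_bimod[OF s])
  interpret r: hilbert_bimod "fib X r" by (rule hilbert_bimod[OF r])
  consider "s = 0" | "s \<noteq> 0" "r = 0" | "s \<noteq> 0" "r \<noteq> 0" by blast
  then show ?thesis
  proof cases
    case 1
    \<comment> \<open>On the unit fibre right linearity makes \<open>S\<close> the left
      multiplication by the value \<open>c\<close> at the unit.\<close>
    obtain c where c: "S (emb X 1) = emb X c"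
      using s.adjointables_in[OF S] emb_in emb_surj 1 by metis
    have "left_op (fib X r) c = T"
    proof (rule adjointables_eqI[OF s r _ T])
      show "left_op (fib X r) c \<in> carr (adjointables (fib X (s + r)))"
        using r.left_op_adjointable 1 by simp
    next
      fix \<xi> \<eta> assume \<xi>: "\<xi> \<in> fsp X s" and \<eta>: "\<eta> \<in> fsp X r"
      obtain a where a: "\<xi> = emb X a" using \<xi> 1 emb_surj by metis
      have "S \<xi> = S (ract (fib X 0) (emb X 1) a)" by (simp add: a ract_emb)
      also have "\<dots> = emb X (c * a)"
        using s.adjointables_ract[OF S, of "emb X 1" a] 1 by (simp add: emb_in c ract_emb)
      finally have "S \<xi> = emb X (c * a)" .
      with 1 r \<eta> have "left_op (fib X r) c (pmul X s r \<xi> \<eta>) = pmul X s r (S \<xi>) \<eta>"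
        by (simp add: a pmul_0_left left_op_def r.lact_in r.lact_lact)
      then show "left_op (fib X r) c (pmul X s r \<xi> \<eta>) = T (pmul X s r \<xi> \<eta>)"
        using eq[OF \<xi> \<eta>] by simp
    qed
    with 1 show ?thesis by (simp add: amplify_def c inv_emb)
  next
    case 2
    have "S = T"
    proof (rule adjointables_eqI[OF s r _ T])
      show "S \<in> carr (adjointables (fib X (s + r)))" using S 2 by simp
    next
      fix \<xi> \<eta> assume \<xi>: "\<xi> \<in> fsp X s" and \<eta>: "\<eta> \<in> fsp X r"
      obtain a where a: "\<eta> = emb X a" using \<eta> 2 emb_surj by metis
      show "S (pmul X s r \<xi> \<eta>) = T (pmul X s r \<xi> \<eta>)"
        using eq[OF \<xi> \<eta>] 2 s \<xi>
        by (simp add: a pmul_0_right s.adjointables_in[OF S] s.adjointables_ract[OF S])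
    qed
    with 2 show ?thesis by (simp add: amplify_def)
  next
    case 3
    have "(THE T. T \<in> carr (adjointables (fib X (s + r))) \<and>
        (\<forall>\<xi>\<in>fsp X s. \<forall>\<eta>\<in>fsp X r. T (pmul X s r \<xi> \<eta>) = pmul X s r (S \<xi>) \<eta>)) = T"
    proof (rule the_equality)
      fix T' assume T': "T' \<in> carr (adjointables (fib X (s + r))) \<and>
        (\<forall>\<xi>\<in>fsp X s. \<forall>\<eta>\<in>fsp X r. T' (pmul X s r \<xi> \<eta>) = pmul X s r (S \<xi>) \<eta>)"
      show "T' = T"
        by (rule adjointables_eqI[OF s r _ T]) (use T' eq in simp_all)
    qed (use T eq in simp)
    with 3 show ?thesis by (simp add: amplify_def)
  qed
qed

text \<open>Tensoring the projection onto the line of \<open>u s l\<close> with the identity gives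
  the projection onto the products of \<open>u s l\<close> with all \<open>u r q\<close>, and these
  are again basis vectors.\<close>

lemma amplify_basis_proj:
  assumes s: "0 \<le> s" and r: "0 \<le> r" and l: "l < n s"
  shows "amplify X s r (basis_proj s {l}) = basis_proj (s + r) (m s r l ` {..<n r})"
proof -
  interpret s: hilbert_bimod "fib X s" by (rule hilbert_bimod[OF s])
  interpret r: hilbert_bimod "fib X r" by (rule hilbert_bimod[OF r])
  have sr: "0 \<le> s + r" using s r by simp
  interpret sb: orthonormal_basis "fib X s" "n s" "u s" by (rule orthonormal_basis[OF s])
  interpret srb: orthonormal_basis "fib X (s + r)" "n (s + r)" "u (s + r)"
    by (rule orthonormal_basis[OF sr])
  have J: "m s r l ` {..<n r} \<subseteq> {..<n (s + r)}"
    using index_map_less[OF s r l] by auto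
  show ?thesis
  proof (rule amplify_eqI[OF s r])
    show "basis_proj s {l} \<in> carr (adjointables (fib X s))"
      by (rule sb.basis_proj_adjointable) (use l in simp)
    show "basis_proj (s + r) (m s r l ` {..<n r}) \<in> carr (adjointables (fib X (s + r)))"
      by (rule srb.basis_proj_adjointable[OF J])
  next
    fix \<xi> \<eta> assume \<xi>: "\<xi> \<in> fsp X s" and \<eta>: "\<eta> \<in> fsp X r"
    \<comment> \<open>The coefficient of \<open>\<xi>\<close> along \<open>u s l\<close> is carried
      across the tensor product onto \<open>\<eta>\<close>. Expanding the result in the basis over
      \<open>r\<close>, \<open>hip_pmul\<close> recognises the coefficients as those of the product
      over \<open>s + r\<close>.\<close>
    let ?\<eta> = "lact (fib X r) (hip (fib X s) (u s l) \<xi>) \<eta>"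
    have \<eta>': "?\<eta> \<in> fsp X r" by (rule r.lact_in[OF \<eta>])
    have ul: "u s l \<in> fsp X s" by (rule basis_in[OF s l])
    have inj: "inj_on (m s r l) {..<n r}"
      using index_map_inj(2)[OF s r l l] by (auto intro!: inj_onI)
    have "pmul X s r (basis_proj s {l} \<xi>) \<eta> = pmul X s r (u s l) ?\<eta>"
      using \<xi> by (simp add: sb.basis_proj_def pmul_ract_left[OF s r ul \<eta>])
    also have "\<dots> = pmul X s r (u s l) (\<Sum>q<n r. ract (fib X r) (u r q) (hip (fib X r) (u r q) ?\<eta>))"
      using basis_expansion[OF r \<eta>'] by simp
    also have "\<dots> = (\<Sum>q<n r. ract (fib X (s + r)) (u (s + r) (m s r l q)) (hip (fib X r) (u r q) ?\<eta>))"
      by (subst pmul_sum_right[OF s r ul])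
        (auto simp: r.ract_in basis_in[OF r] pmul_ract_right[OF s r ul] pmul_basis[OF s r l]
          intro!: sum.cong)
    also have "\<dots> = (\<Sum>q<n r. ract (fib X (s + r)) (u (s + r) (m s r l q))
        (hip (fib X (s + r)) (u (s + r) (m s r l q)) (pmul X s r \<xi> \<eta>)))"
      by (intro sum.cong)
        (auto simp: hip_pmul[OF s r ul \<xi> _ \<eta>] basis_in[OF r] simp flip: pmul_basis[OF s r l])
    also have "\<dots> = basis_proj (s + r) (m s r l ` {..<n r}) (pmul X s r \<xi> \<eta>)"
      by (simp add: srb.basis_proj_def pmul_in[OF s r \<xi> \<eta>] sum.reindex[OF inj])
    finally show "basis_proj (s + r) (m s r l ` {..<n r}) (pmul X s r \<xi> \<eta>) =
        pmul X s r (basis_proj s {l} \<xi>) \<eta>" ..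
  qed
qed

end

section \<open>The Nica--Toeplitz algebra of a system of finite type\<close>

locale nica_toeplitz_finite_type = finite_type_system X n u m
  for X :: "('g::lattice_ab_group_add, 'a::cstar_algebra, 'x::complex_vector) prodsys"
    and n u m +
  fixes i :: "'g \<Rightarrow> 'x \<Rightarrow> 'b::cstar_algebra"
  assumes nica_toeplitz_algebra: "nica_toeplitz_algebra X i"
begin

abbreviation v :: "'g \<Rightarrow> nat \<Rightarrow> 'b" where
  "v s j \<equiv> i s (u s j)"

abbreviation \<pi> :: "'a \<Rightarrow> 'b" where
  "\<pi> a \<equiv> i 0 (emb X a)"

section \<open>Relations between coefficients and basis isometries\<close>

lemma toeplitz: "toeplitz_rep X type_alg i"
  and nica: "nica_covariant X type_alg i"
  and generates: "cstar_subalgebra hull {i s \<xi> | s \<xi>. 0 \<le> s \<and> \<xi> \<in> fsp X s} = UNIV"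
  using nica_toeplitz_algebra by (simp_all add: nica_toeplitz_algebra_def)

lemma i_add: "0 \<le> s \<Longrightarrow> \<xi> \<in> fsp X s \<Longrightarrow> \<eta> \<in> fsp X s \<Longrightarrow> i s (\<xi> + \<eta>) = i s \<xi> + i s \<eta>"
  and i_mult: "0 \<le> s \<Longrightarrow> 0 \<le> r \<Longrightarrow> \<xi> \<in> fsp X s \<Longrightarrow> \<eta> \<in> fsp X r \<Longrightarrow>
    i s \<xi> * i r \<eta> = i (s + r) (pmul X s r \<xi> \<eta>)"
  and star_i_mult: "0 \<le> s \<Longrightarrow> \<xi> \<in> fsp X s \<Longrightarrow> \<eta> \<in> fsp X s \<Longrightarrow>
    star (i s \<xi>) * i s \<eta> = \<pi> (hip (fib X s) \<xi> \<eta>)"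
  and \<pi>_add: "\<pi> (a + b) = \<pi> a + \<pi> b"
  and \<pi>_mult: "\<pi> (a * b) = \<pi> a * \<pi> b"
  and star_\<pi>: "star (\<pi> a) = \<pi> (star a)"
  using toeplitz by (simp_all add: toeplitz_rep_def type_alg_def star_hom_def)

lemma \<pi>_zero: "\<pi> 0 = 0"
  using \<pi>_add[of 0 0] by simp

lemma i_zero: "0 \<le> s \<Longrightarrow> i s 0 = 0"
  using i_add[of s 0 0] hilbert_mod.hspace_zero[OF hilbert_mod] by simp

lemma i_sum:
  assumes "0 \<le> s" "\<And>k. k \<in> A \<Longrightarrow> f k \<in> fsp X s"
  shows "i s (sum f A) = (\<Sum>k\<in>A. i s (f k))"
  using assms(2)
  by (induction A rule: infinite_finite_induct)
    (simp_all add: assms(1) i_zero i_add hilbert_mod.hspace_sum[OF hilbert_mod[OF assms(1)]])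

lemma i_ract: "0 \<le> s \<Longrightarrow> \<xi> \<in> fsp X s \<Longrightarrow> i s (ract (fib X s) \<xi> a) = i s \<xi> * \<pi> a"
  by (simp add: i_mult emb_in pmul_0_right)

lemma i_lact: "0 \<le> s \<Longrightarrow> \<xi> \<in> fsp X s \<Longrightarrow> i s (lact (fib X s) a \<xi>) = \<pi> a * i s \<xi>"
  by (simp add: i_mult emb_in pmul_0_left)

lemma i_expansion:
  assumes s: "0 \<le> s" and \<xi>: "\<xi> \<in> fsp X s"
  shows "i s \<xi> = (\<Sum>j<n s. v s j * \<pi> (hip (fib X s) (u s j) \<xi>))"
proof -
  have "i s \<xi> = i s (\<Sum>j<n s. ract (fib X s) (u s j) (hip (fib X s) (u s j) \<xi>))"
    using basis_expansion[OF s \<xi>] by simp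
  also have "\<dots> = (\<Sum>j<n s. i s (ract (fib X s) (u s j) (hip (fib X s) (u s j) \<xi>)))"
    by (rule i_sum[OF s]) (simp add: hilbert_mod.ract_in[OF hilbert_mod[OF s]] basis_in[OF s])
  also have "\<dots> = (\<Sum>j<n s. v s j * \<pi> (hip (fib X s) (u s j) \<xi>))"
    by (intro sum.cong) (auto simp: i_ract[OF s] basis_in[OF s])
  finally show ?thesis .
qed

text \<open>The rule for moving a coefficient to the right past a basis isometry: expand the vector
  \<open>lact (fib X s) a (u s k)\<close> in the right basis.\<close>

lemma \<pi>_v:
  assumes "0 \<le> s" "k < n s"
  shows "\<pi> a * v s k = (\<Sum>t<n s. v s t * \<pi> (hip (fib X s) (u s t) (lact (fib X s) a (u s k))))"
  using i_expansion[OF assms(1) hilbert_bimod.lact_in[OF hilbert_bimod[OF assms(1)] basis_in[OF assms]]]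
  by (simp add: i_lact basis_in assms)

text \<open>The adjoint of \<open>\<pi>_v\<close> at \<open>star b\<close>, with the coefficients
  rewritten by adjointness of the left action.\<close>

lemma star_v_\<pi>:
  assumes s: "0 \<le> s" and k: "k < n s"
  shows "star (v s k) * \<pi> b =
    (\<Sum>t<n s. \<pi> (hip (fib X s) (u s k) (lact (fib X s) b (u s t))) * star (v s t))"
proof -
  interpret hilbert_bimod "fib X s" by (rule hilbert_bimod[OF s])
  have "star (hip (fib X s) (u s t) (lact (fib X s) (star b) (u s k))) =
      hip (fib X s) (u s k) (lact (fib X s) b (u s t))" if "t < n s" for t
    using that k basis_in[OF s] by (simp add: star_hip lact_in hip_lact_left star_star)
  then show ?thesis
    using arg_cong[OF \<pi>_v[OF s k, of "star b"], of star]
    by (simp add: star_mult star_sum star_\<pi> star_star)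
qed

lemma v_mult: "0 \<le> s \<Longrightarrow> 0 \<le> r \<Longrightarrow> j < n s \<Longrightarrow> k < n r \<Longrightarrow> v s j * v r k = v (s + r) (m s r j k)"
  by (simp add: i_mult basis_in pmul_basis)

text \<open>The elements fixed by \<open>\<pi> 1\<close> from both sides form a C*-subalgebra. It
  contains the generators because the unit acts trivially on every fibre from either side, so it
  contains 1.\<close>

lemma \<pi>_one: "\<pi> 1 = 1"
proof -
  let ?U = "{x. \<pi> 1 * x = x \<and> x * \<pi> 1 = x}"
  have star1: "star (\<pi> 1) = \<pi> 1" by (simp add: star_\<pi> star_one)
  have "cstar_subalgebra ?U"
    unfolding cstar_subalgebra_def csubspace_def
  proof (intro conjI allI ballI)
    show "closed ?U"
      by (intro closed_Collect_conj closed_Collect_eq continuous_intros)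
    fix x assume "x \<in> ?U"
    then have x: "\<pi> 1 * x = x" "x * \<pi> 1 = x" by auto
    show "star x \<in> ?U"
      using arg_cong[OF x(1), of star] arg_cong[OF x(2), of star] by (simp add: star_mult star1)
    show "c *\<^sub>C x \<in> ?U" for c
      using x by (simp add: mult_scaleC_left mult_scaleC_right)
    fix y assume "y \<in> ?U"
    then have y: "\<pi> 1 * y = y" "y * \<pi> 1 = y" by auto
    show "x + y \<in> ?U" using x y by (simp add: distrib_left distrib_right)
    show "x * y \<in> ?U" using x y by (metis (mono_tags, lifting) mem_Collect_eq mult.assoc)
  qed simp
  moreover have "{i s \<xi> | s \<xi>. 0 \<le> s \<and> \<xi> \<in> fsp X s} \<subseteq> ?U"
    using hilbert_mod.ract_one[OF hilbert_mod] by (auto simp: lact_one simp flip: i_ract i_lact)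
  ultimately have "cstar_subalgebra hull {i s \<xi> | s \<xi>. 0 \<le> s \<and> \<xi> \<in> fsp X s} \<subseteq> ?U"
    by (intro hull_minimal)
  then have "1 \<in> ?U" unfolding generates by blast
  then show ?thesis by simp
qed

lemma star_v_v:
  "0 \<le> s \<Longrightarrow> j < n s \<Longrightarrow> k < n s \<Longrightarrow> star (v s j) * v s k = (if j = k then 1 else 0)"
  by (simp add: star_i_mult basis_in hip_basis \<pi>_one \<pi>_zero)

lemma star_v_v_mult:
  "0 \<le> s \<Longrightarrow> j < n s \<Longrightarrow> k < n s \<Longrightarrow> star (v s j) * (v s k * x) = (if j = k then x else 0)"
  by (simp add: star_v_v flip: mult.assoc)

text \<open>Pairs \<open>(q, p)\<close> such that \<open>1\<^sup>s\<^sub>l 1\<^sup>r\<^sub>q = 1\<^sup>r\<^sub>k 1\<^sup>s\<^sub>p\<close>.\<close>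

definition matching :: "'g \<Rightarrow> 'g \<Rightarrow> nat \<Rightarrow> nat \<Rightarrow> (nat \<times> nat) set" where
  "matching s r l k = {(q, p). q < n r \<and> p < n s \<and> m s r l q = m r s k p}"

lemma matching_swap: "matching r s k l = prod.swap ` matching s r l k"
  by (auto simp: matching_def image_iff)

text \<open>For co-prime indices the least upper bound is \<open>s + r\<close>. Nica covariance,
  applied to rank-one projections, turns the product into the composite of two amplified basis
  projections, that is, into the intersection of their index sets.\<close>

lemma range_projections_mult:
  assumes s: "0 \<le> s" and r: "0 \<le> r" and coprime: "inf s r = 0" and l: "l < n s" and k: "k < n r"
  shows "(v s l * star (v s l)) * (v r k * star (v r k)) =
    (\<Sum>M\<in>m s r l ` {..<n r} \<inter> m r s k ` {..<n s}. v (s + r) M * star (v (s + r) M))"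
proof -
  obtain \<Psi> where \<Psi>: "induced_homs X type_alg i \<Psi>"
    and covariant: "\<And>s r S T. 0 \<le> s \<Longrightarrow> 0 \<le> r \<Longrightarrow> S \<in> carr (compacts (fib X s)) \<Longrightarrow>
      T \<in> carr (compacts (fib X r)) \<Longrightarrow> \<Psi> s S * \<Psi> r T =
      \<Psi> (sup s r) (amplify X s (sup s r - s) S \<circ> amplify X r (sup s r - r) T)"
    using nica unfolding nica_covariant_def by (auto simp: type_alg_def)
  have sr: "0 \<le> s + r" using s r by simp
  have sup: "sup s r = s + r" using coprime add_eq_inf_sup[of s r] by simp
  have \<Psi>_proj: "\<Psi> q (basis_proj q J) = (\<Sum>j\<in>J. v q j * star (v q j))"
    if q: "0 \<le> q" and J: "J \<subseteq> {..<n q}" for q J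
  proof -
    interpret qb: orthonormal_basis "fib X q" "n q" "u q" by (rule orthonormal_basis[OF q])
    have hom: "star_hom (compacts (fib X q)) type_alg (\<Psi> q)"
      and theta: "\<And>\<xi> \<eta>. \<xi> \<in> fsp X q \<Longrightarrow> \<eta> \<in> fsp X q \<Longrightarrow>
        \<Psi> q (theta (fib X q) \<xi> \<eta>) = i q \<xi> * star (i q \<eta>)"
      using \<Psi> q by (simp_all add: induced_homs_def type_alg_def)
    have "finite J" using J finite_subset by blast
    then show ?thesis using J
    proof (induction J)
      case empty
      have "basis_proj q {} \<in> carr (compacts (fib X q))" by (rule qb.basis_proj_compact) simp
      \<comment> \<open>Preservation of zero is read off from homogeneity with scalar 0, as
        \<open>star_hom\<close> does not list it.\<close>
      then have "\<Psi> q (cscale (compacts (fib X q)) 0 (basis_proj q {})) = 0 *\<^sub>C \<Psi> q (basis_proj q {})"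
        using hom by (simp add: star_hom_def type_alg_def)
      moreover have "cscale (compacts (fib X q)) 0 (basis_proj q {}) = basis_proj q {}"
        by (auto simp: compacts_def adjointables_def qb.basis_proj_def scaleC_zero_left)
      ultimately show ?case by (simp add: scaleC_zero_left)
    next
      case (insert j J)
      have "basis_proj q {j} \<in> carr (compacts (fib X q))" "basis_proj q J \<in> carr (compacts (fib X q))"
        using insert.prems by (auto intro!: qb.basis_proj_compact)
      then have "\<Psi> q (cadd (compacts (fib X q)) (basis_proj q {j}) (basis_proj q J)) =
          \<Psi> q (basis_proj q {j}) + \<Psi> q (basis_proj q J)"
        using hom by (simp add: star_hom_def type_alg_def)
      moreover have "cadd (compacts (fib X q)) (basis_proj q {j}) (basis_proj q J) = basis_proj q (insert j J)"
        using insert.hyps by (auto simp: compacts_def adjointables_def qb.basis_proj_def)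
      moreover have "\<Psi> q (basis_proj q {j}) = v q j * star (v q j)"
        using insert.prems by (simp add: qb.basis_proj_singleton theta basis_in[OF q])
      ultimately show ?case
        using insert by simp
    qed
  qed
  interpret srb: orthonormal_basis "fib X (s + r)" "n (s + r)" "u (s + r)"
    by (rule orthonormal_basis[OF sr])
  have J: "m s r l ` {..<n r} \<subseteq> {..<n (s + r)}" "m r s k ` {..<n s} \<subseteq> {..<n (s + r)}"
    using index_map_less[OF s r l] index_map_less[OF r s k] by (auto simp: add.commute)
  have "(v s l * star (v s l)) * (v r k * star (v r k)) =
      \<Psi> s (basis_proj s {l}) * \<Psi> r (basis_proj r {k})"
    using \<Psi>_proj[OF s, of "{l}"] \<Psi>_proj[OF r, of "{k}"] l k by simp
  also have "\<dots> = \<Psi> (s + r) (amplify X s r (basis_proj s {l}) \<circ> amplify X r s (basis_proj r {k}))"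
    using covariant[OF s r orthonormal_basis.basis_proj_compact[OF orthonormal_basis[OF s], of "{l}"]
      orthonormal_basis.basis_proj_compact[OF orthonormal_basis[OF r], of "{k}"]] l k
    by (simp add: sup)
  also have "amplify X s r (basis_proj s {l}) \<circ> amplify X r s (basis_proj r {k}) =
      basis_proj (s + r) (m s r l ` {..<n r} \<inter> m r s k ` {..<n s})"
    using srb.basis_proj_comp[OF J]
    by (simp add: amplify_basis_proj[OF s r l] amplify_basis_proj[OF r s k] add.commute[of r s])
  also have "\<Psi> (s + r) \<dots> =
      (\<Sum>M\<in>m s r l ` {..<n r} \<inter> m r s k ` {..<n s}. v (s + r) M * star (v (s + r) M))"
    by (rule \<Psi>_proj[OF sr]) (use J in blast)
  finally show ?thesis .
qed

lemma star_v_v_coprime: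
  assumes s: "0 \<le> s" and r: "0 \<le> r" and coprime: "inf s r = 0" and l: "l < n s" and k: "k < n r"
  shows "star (v s l) * v r k = (\<Sum>(q, p)\<in>matching s r l k. v r q * star (v s p))"
proof -
  let ?J = "m s r l ` {..<n r} \<inter> m r s k ` {..<n s}"
  \<comment> \<open>Both range projections can be inserted for free, since the \<open>v\<close> are
    isometries; their product is then known.\<close>
  have "star (v s l) * v r k =
      star (v s l) * ((v s l * star (v s l)) * (v r k * star (v r k))) * v r k"
    by (simp add: mult.assoc star_v_v_mult star_v_v s r l k)
  also have "\<dots> = (\<Sum>M\<in>?J. star (v s l) * v (s + r) M * (star (v (s + r) M) * v r k))"
    unfolding range_projections_mult[OF assms] by (simp add: sum_distrib_left sum_distrib_right mult.assoc)
  also have "\<dots> = (\<Sum>(q, p)\<in>matching s r l k. v r q * star (v s p))"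
  \<comment> \<open>An index \<open>M\<close> in the intersection factors both through
    \<open>l\<close> and through \<open>k\<close>. The remaining factors \<open>q\<close> and
    \<open>p\<close> are unique by injectivity of the index maps, which makes the two descriptions
    well defined.\<close>
  proof (rule sum.reindex_bij_witness[of _ "\<lambda>(q, p). m s r l q"
      "\<lambda>M. (THE q. q < n r \<and> m s r l q = M, THE p. p < n s \<and> m r s k p = M)"], goal_cases)
    have the1: "(THE q'. q' < n r \<and> m s r l q' = m s r l q) = q" if "q < n r" for q
      by (rule the_equality) (use that index_map_inj(2)[OF s r l l] in auto)
    have the2: "(THE p'. p' < n s \<and> m r s k p' = m r s k p) = p" if "p < n s" for p
      by (rule the_equality) (use that index_map_inj(2)[OF r s k k] in auto)
    {
      case (1 M)
      then obtain q where "q < n r" "M = m s r l q" by auto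
      then show ?case by (simp add: the1)
    next
      case (2 M)
      then obtain q p where "q < n r" "p < n s" "M = m s r l q" "m s r l q = m r s k p"
        by auto
      then show ?case using the1[of q] the2[of p] by (simp add: matching_def)
    next
      case (3 z)
      then obtain q p where "z = (q, p)" "q < n r" "p < n s" "m s r l q = m r s k p"
        by (auto simp: matching_def)
      then show ?case using the1[of q] the2[of p] by simp
    next
      case (4 z)
      then show ?case by (auto simp: matching_def)
    next
      case (5 M)
      then obtain q p where M: "q < n r" "p < n s" "M = m s r l q" "m s r l q = m r s k p"
        by auto
      have "v (s + r) M = v s l * v r q" "v (s + r) M = v r k * v s p"
        using M s r l k by (simp_all add: v_mult add.commute)
      then have "star (v s l) * v (s + r) M * (star (v (s + r) M) * v r k) =
          star (v s l) * (v s l * v r q) * (star (v r k * v s p) * v r k)"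
        by metis
      also have "\<dots> = v r q * star (v s p)"
        using M s r l k by (simp add: star_mult mult.assoc star_v_v_mult star_v_v)
      finally show ?case using M the1[of q] the2[of p] by simp
    }
  qed
  finally show ?thesis .
qed

text \<open>The common part over \<open>w\<close> cancels by orthonormality and leaves the co-prime
  case.\<close>

lemma star_vv_vv:
  assumes w: "0 \<le> w" and s: "0 \<le> s" and r: "0 \<le> r" and coprime: "inf s r = 0"
    and l: "l0 < n w" "l1 < n s" and k: "k0 < n w" "k1 < n r"
  shows "star (v w l0 * v s l1) * (v w k0 * v r k1) =
    (if l0 = k0 then \<Sum>(q, p)\<in>matching s r l1 k1. v r q * star (v s p) else 0)"
  using star_v_v_coprime[OF s r coprime l(2) k(2)]
  by (simp add: star_mult mult.assoc star_v_v_mult w l k)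

text \<open>After the inner isometries are exchanged, \<open>\<pi> a\<close> is moved right past an
  isometry over \<open>\<gamma>\<close> and \<open>\<pi> b\<close> left past an adjoint over
  \<open>\<alpha>\<close>. The new indices \<open>t\<close> and \<open>t'\<close> come from these
  two moves, and the coefficients meet in the middle.\<close>

lemma word_mult:
  assumes s: "0 \<le> s" and q: "0 \<le> q" and w: "0 \<le> w" and \<alpha>: "0 \<le> \<alpha>" and \<gamma>: "0 \<le> \<gamma>"
    and coprime: "inf \<alpha> \<gamma> = 0"
    and j: "j < n s" and h: "h < n q" and l: "l0 < n w" "l1 < n \<alpha>" and k: "k0 < n w" "k1 < n \<gamma>"
  shows "(v s j * \<pi> a * star (v w l0 * v \<alpha> l1)) * (v w k0 * v \<gamma> k1 * \<pi> b * star (v q h)) =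
    (if l0 = k0 then
       \<Sum>z\<in>matching \<alpha> \<gamma> l1 k1. \<Sum>t<n \<gamma>. \<Sum>t'<n \<alpha>.
         v (s + \<gamma>) (m s \<gamma> j t) *
         \<pi> (hip (fib X \<gamma>) (u \<gamma> t) (lact (fib X \<gamma>) a (u \<gamma> (fst z))) *
            hip (fib X \<alpha>) (u \<alpha> (snd z)) (lact (fib X \<alpha>) b (u \<alpha> t'))) *
         star (v (q + \<alpha>) (m q \<alpha> h t'))
     else 0)"
proof -
  have term_eq: "v s j * \<pi> a * (v \<gamma> A * star (v \<alpha> B)) * (\<pi> b * star (v q h)) =
    (\<Sum>t<n \<gamma>. \<Sum>t'<n \<alpha>. v (s + \<gamma>) (m s \<gamma> j t) *
         \<pi> (hip (fib X \<gamma>) (u \<gamma> t) (lact (fib X \<gamma>) a (u \<gamma> A)) *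
            hip (fib X \<alpha>) (u \<alpha> B) (lact (fib X \<alpha>) b (u \<alpha> t'))) *
         star (v (q + \<alpha>) (m q \<alpha> h t')))"
    if A: "A < n \<gamma>" and B: "B < n \<alpha>" for A B
  proof -
    have "v s j * \<pi> a * (v \<gamma> A * star (v \<alpha> B)) * (\<pi> b * star (v q h)) =
        v s j * (\<pi> a * v \<gamma> A) * (star (v \<alpha> B) * \<pi> b) * star (v q h)"
      by (simp add: mult.assoc)
    also have "\<dots> = (\<Sum>t<n \<gamma>. \<Sum>t'<n \<alpha>. (v s j * v \<gamma> t) *
         \<pi> (hip (fib X \<gamma>) (u \<gamma> t) (lact (fib X \<gamma>) a (u \<gamma> A)) *
            hip (fib X \<alpha>) (u \<alpha> B) (lact (fib X \<alpha>) b (u \<alpha> t'))) *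
         star (v q h * v \<alpha> t'))"
      unfolding \<pi>_v[OF \<gamma> A] star_v_\<pi>[OF \<alpha> B]
      by (subst sum.swap)
        (simp add: sum_distrib_left sum_distrib_right star_mult \<pi>_mult mult.assoc)
    also have "\<dots> = (\<Sum>t<n \<gamma>. \<Sum>t'<n \<alpha>. v (s + \<gamma>) (m s \<gamma> j t) *
         \<pi> (hip (fib X \<gamma>) (u \<gamma> t) (lact (fib X \<gamma>) a (u \<gamma> A)) *
            hip (fib X \<alpha>) (u \<alpha> B) (lact (fib X \<alpha>) b (u \<alpha> t'))) *
         star (v (q + \<alpha>) (m q \<alpha> h t')))"
      by (intro sum.cong refl) (simp add: v_mult[OF s \<gamma> j] v_mult[OF q \<alpha> h])
    finally show ?thesis .
  qed
  have "(v s j * \<pi> a * star (v w l0 * v \<alpha> l1)) * (v w k0 * v \<gamma> k1 * \<pi> b * star (v q h)) =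
      v s j * \<pi> a * (star (v w l0 * v \<alpha> l1) * (v w k0 * v \<gamma> k1)) * (\<pi> b * star (v q h))"
    by (simp add: mult.assoc)
  also have "\<dots> = (if l0 = k0 then \<Sum>z\<in>matching \<alpha> \<gamma> l1 k1.
      v s j * \<pi> a * (v \<gamma> (fst z) * star (v \<alpha> (snd z))) * (\<pi> b * star (v q h)) else 0)"
    unfolding star_vv_vv[OF w \<alpha> \<gamma> coprime l k]
    by (simp add: sum_distrib_left sum_distrib_right case_prod_unfold)
  also have "(\<Sum>z\<in>matching \<alpha> \<gamma> l1 k1.
      v s j * \<pi> a * (v \<gamma> (fst z) * star (v \<alpha> (snd z))) * (\<pi> b * star (v q h))) =
      (\<Sum>z\<in>matching \<alpha> \<gamma> l1 k1. \<Sum>t<n \<gamma>. \<Sum>t'<n \<alpha>. v (s + \<gamma>) (m s \<gamma> j t) *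
         \<pi> (hip (fib X \<gamma>) (u \<gamma> t) (lact (fib X \<gamma>) a (u \<gamma> (fst z))) *
            hip (fib X \<alpha>) (u \<alpha> (snd z)) (lact (fib X \<alpha>) b (u \<alpha> t'))) *
         star (v (q + \<alpha>) (m q \<alpha> h t')))"
    by (intro sum.cong refl term_eq) (auto simp: matching_def)
  finally show ?thesis .
qed

section \<open>Words, their degrees and density\<close>

lemma coprime_remainders: "inf (r - inf r p) (p - inf r p) = (0::'g)"
proof -
  have "inf (r - inf r p) (p - inf r p) = inf r p - inf r p"
    by (simp only: diff_conv_add_uminus add_inf_distrib_right)
  then show ?thesis by simp
qed

definition words :: "'g \<Rightarrow> 'g \<Rightarrow> 'b set" where
  "words s r = {v s j * \<pi> a * star (v r l) | j a l. j < n s \<and> l < n r}"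

text \<open>The inner degrees \<open>r\<close> and \<open>p\<close> are divided by their greatest
  lower bound, so that \<open>word_mult\<close> applies to the co-prime remainders. Recording the
  degrees of the result later shows which products \<open>\<omega>\<close> annihilates.\<close>

lemma words_mult:
  assumes pos: "0 \<le> s" "0 \<le> r" "0 \<le> p" "0 \<le> q" and c: "c \<in> words s r" and d: "d \<in> words p q"
  shows "c * d \<in> csubspace hull words (s + (p - inf r p)) (q + (r - inf r p))"
proof -
  define w where "w = inf r p"
  define \<alpha> \<gamma> where "\<alpha> = r - w" and "\<gamma> = p - w"
  have "0 \<le> w" "w \<le> r" "w \<le> p" "inf (r - w) (p - w) = 0"
    using pos coprime_remainders[of r p] unfolding w_def by simp_all
  then have w: "0 \<le> w" "0 \<le> \<alpha>" "0 \<le> \<gamma>" "inf \<alpha> \<gamma> = 0" "r = w + \<alpha>" "p = w + \<gamma>"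
    by (simp_all add: \<alpha>_def \<gamma>_def)
  obtain j a l where c: "c = v s j * \<pi> a * star (v r l)" "j < n s" "l < n r"
    using c by (auto simp: words_def)
  obtain k b h where d: "d = v p k * \<pi> b * star (v q h)" "k < n p" "h < n q"
    using d by (auto simp: words_def)
  obtain l0 l1 where l: "l0 < n w" "l1 < n \<alpha>" "l = m w \<alpha> l0 l1"
    by (rule index_map_surj[OF w(1,2) c(3)[unfolded w(5)]])
  obtain k0 k1 where k: "k0 < n w" "k1 < n \<gamma>" "k = m w \<gamma> k0 k1"
    by (rule index_map_surj[OF w(1,3) d(2)[unfolded w(6)]])
  have "v r l = v w l0 * v \<alpha> l1" "v p k = v w k0 * v \<gamma> k1"
    using v_mult[OF w(1,2) l(1,2)] v_mult[OF w(1,3) k(1,2)] l(3) k(3) w(5,6) by simp_all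
  then have "c * d = (v s j * \<pi> a * star (v w l0 * v \<alpha> l1)) * (v w k0 * v \<gamma> k1 * \<pi> b * star (v q h))"
    using c d by simp
  moreover have "v (s + \<gamma>) (m s \<gamma> j t) * \<pi> e * star (v (q + \<alpha>) (m q \<alpha> h t')) \<in>
      csubspace hull words (s + \<gamma>) (q + \<alpha>)" if "t < n \<gamma>" "t' < n \<alpha>" for t t' e
    using index_map_less[OF pos(1) w(3) c(2) that(1)] index_map_less[OF pos(4) w(2) d(3) that(2)]
    unfolding words_def by (intro hull_inc CollectI) blast
  moreover have "0 \<in> csubspace hull words (s + \<gamma>) (q + \<alpha>)"
    using csubspace_hull[of "words (s + \<gamma>) (q + \<alpha>)"] by (simp add: csubspace_def)
  ultimately have "c * d \<in> csubspace hull words (s + \<gamma>) (q + \<alpha>)"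
    by (auto simp: word_mult[OF pos(1,4) w(1-4) c(2) d(3) l(1,2) k(1,2)]
        intro!: csubspace_sum[OF csubspace_hull])
  then show ?thesis unfolding \<alpha>_def \<gamma>_def w_def .
qed

lemma i_star_i_in_span_words:
  assumes s: "0 \<le> s" and r: "0 \<le> r" and \<xi>: "\<xi> \<in> fsp X s" and \<eta>: "\<eta> \<in> fsp X r"
  shows "i s \<xi> * star (i r \<eta>) \<in> csubspace hull words s r"
proof -
  have "i s \<xi> * star (i r \<eta>) = (\<Sum>l<n r. \<Sum>j<n s. v s j *
      \<pi> (hip (fib X s) (u s j) \<xi> * star (hip (fib X r) (u r l) \<eta>)) * star (v r l))"
    by (simp add: i_expansion[OF s \<xi>] i_expansion[OF r \<eta>] star_sum star_mult star_\<pi> \<pi>_mult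
        sum_distrib_left sum_distrib_right mult.assoc)
  moreover have "v s j * \<pi> a * star (v r l) \<in> csubspace hull words s r" if "j < n s" "l < n r" for j a l
    by (rule hull_inc) (use that in \<open>auto simp: words_def\<close>)
  ultimately show ?thesis
    by (auto intro!: csubspace_sum[OF csubspace_hull])
qed

definition all_words :: "'b set" where
  "all_words = (\<Union>s\<in>{0..}. \<Union>r\<in>{0..}. words s r)"

lemma words_subset_all: "0 \<le> s \<Longrightarrow> 0 \<le> r \<Longrightarrow> words s r \<subseteq> all_words"
  by (auto simp: all_words_def)

lemma span_words_subset_all:
  "0 \<le> s \<Longrightarrow> 0 \<le> r \<Longrightarrow> csubspace hull words s r \<subseteq> csubspace hull all_words"
  by (intro hull_mono words_subset_all)

text \<open>Products of words are sums of words and adjoints of words are words, so the closed span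
  is a C*-subalgebra. It contains the generators, since \<open>i s \<xi>\<close> is
  \<open>i s \<xi> * star (\<pi> 1)\<close>.\<close>

lemma closure_all_words: "closure (csubspace hull all_words) = UNIV"
proof -
  have "cstar_subalgebra (closure (csubspace hull all_words))"
  proof (rule cstar_subalgebra_closed_span)
    fix x y assume "x \<in> all_words" "y \<in> all_words"
    then obtain s r p q where *: "0 \<le> s" "0 \<le> r" "0 \<le> p" "0 \<le> q" "x \<in> words s r" "y \<in> words p q"
      by (auto simp: all_words_def)
    moreover have "0 \<le> s + (p - inf r p)" "0 \<le> q + (r - inf r p)"
      using * by (intro add_nonneg_nonneg; simp only: diff_ge_0_iff_ge inf_le1 inf_le2)+
    ultimately show "x * y \<in> csubspace hull all_words"
      using words_mult span_words_subset_all by blast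
  next
    fix x assume "x \<in> all_words"
    then obtain s r where *: "0 \<le> s" "0 \<le> r" "x \<in> words s r"
      by (auto simp: all_words_def)
    then have "star x \<in> words r s"
      by (force simp: words_def star_mult star_star star_\<pi> mult.assoc)
    then show "star x \<in> all_words" using * words_subset_all by blast
  qed
  moreover have "{i s \<xi> | s \<xi>. 0 \<le> s \<and> \<xi> \<in> fsp X s} \<subseteq> closure (csubspace hull all_words)"
  proof
    fix x assume "x \<in> {i s \<xi> | s \<xi>. 0 \<le> s \<and> \<xi> \<in> fsp X s}"
    then obtain s \<xi> where *: "0 \<le> s" "\<xi> \<in> fsp X s" "x = i s \<xi>" by blast
    then have "x = i s \<xi> * star (\<pi> 1)" by (simp add: \<pi>_one star_one)
    also have "\<dots> \<in> csubspace hull words s 0"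
      using * by (intro i_star_i_in_span_words emb_in) simp_all
    finally show "x \<in> closure (csubspace hull all_words)"
      using * span_words_subset_all[of s 0] closure_subset by blast
  qed
  ultimately show ?thesis
    using hull_minimal[of _ "closure (csubspace hull all_words)" cstar_subalgebra] generates by blast
qed

lemma core_subset: "core X i \<subseteq> closure (csubspace hull (\<Union>s\<in>{0..}. words s s))"
  unfolding core_def
proof (intro closure_mono hull_minimal csubspace_hull subsetI)
  fix x assume "x \<in> {i s \<xi> * star (i s \<eta>) | s \<xi> \<eta>. 0 \<le> s \<and> \<xi> \<in> fsp X s \<and> \<eta> \<in> fsp X s}"
  then obtain s \<xi> \<eta> where *: "0 \<le> s" "\<xi> \<in> fsp X s" "\<eta> \<in> fsp X s" "x = i s \<xi> * star (i s \<eta>)"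
    by blast
  then have "x \<in> csubspace hull words s s" using i_star_i_in_span_words by simp
  moreover have "csubspace hull words s s \<subseteq> csubspace hull (\<Union>s\<in>{0..}. words s s)"
    using * by (intro hull_mono) auto
  ultimately show "x \<in> csubspace hull (\<Union>s\<in>{0..}. words s s)" by blast
qed

text \<open>Associativity applied to basis vectors. Equal basis vectors have equal indices, because
  otherwise their inner product would be both 0 and 1.\<close>

lemma index_map_assoc:
  assumes "0 \<le> s" "0 \<le> r" "0 \<le> q" "j < n s" "k < n r" "l < n q"
  shows "m (s + r) q (m s r j k) l = m s (r + q) j (m r q k l)"
proof -
  have pos: "0 \<le> s + r" "0 \<le> r + q" "0 \<le> s + (r + q)" using assms by simp_all
  have less: "m s r j k < n (s + r)" "m r q k l < n (r + q)"
    using assms by (simp_all add: index_map_less)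
  have less': "m (s + r) q (m s r j k) l < n (s + (r + q))" "m s (r + q) j (m r q k l) < n (s + (r + q))"
    using index_map_less[OF pos(1) assms(3) less(1) assms(6)]
      index_map_less[OF assms(1) pos(2) assms(4) less(2)] by (simp_all add: add.assoc)
  have "u (s + (r + q)) (m (s + r) q (m s r j k) l) = u (s + (r + q)) (m s (r + q) j (m r q k l))"
    using pmul_assoc[OF assms(1-3) basis_in[OF assms(1,4)] basis_in[OF assms(2,5)] basis_in[OF assms(3,6)]]
    by (simp add: pmul_basis assms less pos add.assoc)
  with hip_basis[OF pos(3) less'] hip_basis[OF pos(3) less'(2) less'(2)] show ?thesis
    by (auto split: if_splits)
qed

end

section \<open>Functionals scaling the words\<close>

text \<open>\<open>\<omega>\<close> stands for \<open>\<phi> \<circ> E\<close>. The assumption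
  \<open>\<omega>_word\<close> merges the hypothesis on \<open>\<phi>\<close> for equal degrees with
  the vanishing of \<open>E\<close> on words of unequal degrees. Positivity enters as a premise of
  \<open>\<omega>_invariant\<close> and \<open>\<omega>_kms\<close>.\<close>

locale kms_functional = nica_toeplitz_finite_type X n u m i
  for X :: "('g::lattice_ab_group_add, 'a::cstar_algebra, 'x::complex_vector) prodsys"
    and n u m and i :: "'g \<Rightarrow> 'x \<Rightarrow> 'b::cstar_algebra" +
  fixes N :: "'g \<Rightarrow> real" and \<beta> :: real and \<omega> :: "'b \<Rightarrow> complex"
  assumes positive_hom: "positive_hom N"
    and \<omega>_bounded: "bounded_functional \<omega>"
    and \<omega>_\<pi>_trace: "\<omega> (\<pi> (a * b)) = \<omega> (\<pi> (b * a))"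
    and \<omega>_word: "0 \<le> s \<Longrightarrow> 0 \<le> r \<Longrightarrow> j < n s \<Longrightarrow> l < n r \<Longrightarrow>
      \<omega> (v s j * \<pi> a * star (v r l)) =
      (if s = r \<and> j = l then complex_of_real (N s powr (- \<beta>)) * \<omega> (\<pi> a) else 0)"
begin

lemma N_pos: "0 < N g"
  and N_add: "N (g + h) = N g * N h"
  using positive_hom by (simp_all add: positive_hom_def)

text \<open>Of the words produced by \<open>word_mult\<close>, \<open>\<omega>\<close> sees only
  those whose two outer indices coincide. These form a second matching set, so the result is a
  double sum symmetric in the roles of the two words.\<close>

lemma \<omega>_word_mult:
  assumes w: "0 \<le> w" and w': "0 \<le> w'" and \<alpha>: "0 \<le> \<alpha>" and \<gamma>: "0 \<le> \<gamma>" and coprime: "inf \<alpha> \<gamma> = 0"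
    and j: "j0 < n w'" "j1 < n \<alpha>" and l: "l0 < n w" "l1 < n \<alpha>"
    and k: "k0 < n w" "k1 < n \<gamma>" and h: "h0 < n w'" "h1 < n \<gamma>"
  shows "\<omega> ((v w' j0 * v \<alpha> j1 * \<pi> a * star (v w l0 * v \<alpha> l1)) *
      (v w k0 * v \<gamma> k1 * \<pi> b * star (v w' h0 * v \<gamma> h1))) =
    (if l0 = k0 \<and> j0 = h0 then complex_of_real (N (w' + \<alpha> + \<gamma>) powr (- \<beta>)) *
       (\<Sum>z\<in>matching \<alpha> \<gamma> l1 k1. \<Sum>z'\<in>matching \<alpha> \<gamma> j1 h1.
         \<omega> (\<pi> (hip (fib X \<gamma>) (u \<gamma> (fst z')) (lact (fib X \<gamma>) a (u \<gamma> (fst z))) *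
            hip (fib X \<alpha>) (u \<alpha> (snd z)) (lact (fib X \<alpha>) b (u \<alpha> (snd z'))))))
     else 0)"
proof -
  have pos: "0 \<le> w' + \<alpha>" "0 \<le> w' + \<gamma>" "0 \<le> w' + \<alpha> + \<gamma>" "0 \<le> \<alpha> + \<gamma>"
    using w' \<alpha> \<gamma> by simp_all
  have comm: "w' + \<gamma> + \<alpha> = w' + \<alpha> + \<gamma>" by (simp add: add_ac)
  let ?j = "m w' \<alpha> j0 j1" and ?h = "m w' \<gamma> h0 h1"
  have j': "?j < n (w' + \<alpha>)" and h': "?h < n (w' + \<gamma>)"
    using index_map_less[OF w' \<alpha> j] index_map_less[OF w' \<gamma> h] .
  have less: "m (w' + \<alpha>) \<gamma> ?j t < n (w' + \<alpha> + \<gamma>)" "m (w' + \<gamma>) \<alpha> ?h t' < n (w' + \<alpha> + \<gamma>)"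
    if "t < n \<gamma>" "t' < n \<alpha>" for t t'
    using index_map_less[OF pos(1) \<gamma> j' that(1)] index_map_less[OF pos(2) \<alpha> h' that(2)]
    by (simp_all add: comm)
  \<comment> \<open>Associativity splits off the common part over \<open>w'\<close> on both sides;
    injectivity of the index map then compares the two parts separately.\<close>
  have index_eq: "m (w' + \<alpha>) \<gamma> ?j t = m (w' + \<gamma>) \<alpha> ?h t' \<longleftrightarrow>
      j0 = h0 \<and> (t, t') \<in> matching \<alpha> \<gamma> j1 h1" if t: "t < n \<gamma>" "t' < n \<alpha>" for t t'
  proof -
    have "m \<alpha> \<gamma> j1 t < n (\<alpha> + \<gamma>)" "m \<gamma> \<alpha> h1 t' < n (\<alpha> + \<gamma>)"
      using index_map_less[OF \<alpha> \<gamma> j(2) t(1)] index_map_less[OF \<gamma> \<alpha> h(2) t(2)]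
      by (simp_all add: add.commute)
    then show ?thesis
      using index_map_inj[OF w' pos(4) j(1) h(1)] t
      by (auto simp: index_map_assoc[OF w' \<alpha> \<gamma> j t(1)] index_map_assoc[OF w' \<gamma> \<alpha> h t(2)]
          add.commute[of \<gamma> \<alpha>] matching_def)
  qed
  let ?K = "\<lambda>z t t'. \<pi> (hip (fib X \<gamma>) (u \<gamma> t) (lact (fib X \<gamma>) a (u \<gamma> (fst z))) *
            hip (fib X \<alpha>) (u \<alpha> (snd z)) (lact (fib X \<alpha>) b (u \<alpha> t')))"
  let ?N = "complex_of_real (N (w' + \<alpha> + \<gamma>) powr (- \<beta>))"
  have inner: "(\<Sum>t<n \<gamma>. \<Sum>t'<n \<alpha>. \<omega> (v (w' + \<alpha> + \<gamma>) (m (w' + \<alpha>) \<gamma> ?j t) * ?K z t t' *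
        star (v (w' + \<gamma> + \<alpha>) (m (w' + \<gamma>) \<alpha> ?h t')))) =
      (if j0 = h0 then ?N * (\<Sum>z'\<in>matching \<alpha> \<gamma> j1 h1. \<omega> (?K z (fst z') (snd z'))) else 0)" for z
  proof -
    have "(\<Sum>t<n \<gamma>. \<Sum>t'<n \<alpha>. \<omega> (v (w' + \<alpha> + \<gamma>) (m (w' + \<alpha>) \<gamma> ?j t) * ?K z t t' *
        star (v (w' + \<gamma> + \<alpha>) (m (w' + \<gamma>) \<alpha> ?h t')))) =
      (\<Sum>t<n \<gamma>. \<Sum>t'<n \<alpha>. if j0 = h0 \<and> (t, t') \<in> matching \<alpha> \<gamma> j1 h1 then ?N * \<omega> (?K z t t') else 0)"
      by (intro sum.cong refl) (simp add: comm \<omega>_word[OF pos(3) pos(3) less] index_eq)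
    also have "\<dots> = (\<Sum>z'\<in>{..<n \<gamma>} \<times> {..<n \<alpha>}.
        if z' \<in> matching \<alpha> \<gamma> j1 h1 then if j0 = h0 then ?N * \<omega> (?K z (fst z') (snd z')) else 0 else 0)"
      unfolding sum.cartesian_product by (intro sum.cong refl) auto
    also have "\<dots> = (\<Sum>z'\<in>({..<n \<gamma>} \<times> {..<n \<alpha>}) \<inter> matching \<alpha> \<gamma> j1 h1.
        if j0 = h0 then ?N * \<omega> (?K z (fst z') (snd z')) else 0)"
      by (rule sum.inter_restrict[symmetric]) simp
    also have "({..<n \<gamma>} \<times> {..<n \<alpha>}) \<inter> matching \<alpha> \<gamma> j1 h1 = matching \<alpha> \<gamma> j1 h1"
      by (auto simp: matching_def)
    finally show ?thesis by (simp add: sum_distrib_left)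
  qed
  have "\<omega> ((v w' j0 * v \<alpha> j1 * \<pi> a * star (v w l0 * v \<alpha> l1)) *
      (v w k0 * v \<gamma> k1 * \<pi> b * star (v w' h0 * v \<gamma> h1))) =
    (if l0 = k0 then \<Sum>z\<in>matching \<alpha> \<gamma> l1 k1. \<Sum>t<n \<gamma>. \<Sum>t'<n \<alpha>.
      \<omega> (v (w' + \<alpha> + \<gamma>) (m (w' + \<alpha>) \<gamma> ?j t) * ?K z t t' *
        star (v (w' + \<gamma> + \<alpha>) (m (w' + \<gamma>) \<alpha> ?h t'))) else 0)"
    unfolding v_mult[OF w' \<alpha> j] v_mult[OF w' \<gamma> h]
      word_mult[OF pos(1,2) w \<alpha> \<gamma> coprime j' h' l k]
    by (simp add: bounded_functional_sum[OF \<omega>_bounded] bounded_functional_zero[OF \<omega>_bounded])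
  then show ?thesis
    unfolding inner by (simp add: sum_distrib_left)
qed

lemma \<omega>_span_words_zero:
  assumes "0 \<le> s" "0 \<le> r" "s \<noteq> r" "x \<in> csubspace hull words s r"
  shows "\<omega> x = 0"
proof -
  have "\<omega> x = 0 * \<omega> x"
    by (rule bounded_functionals_eq_on_closed_span[OF _ \<omega>_bounded \<omega>_bounded])
      (use assms closure_subset \<omega>_word in \<open>auto simp: words_def\<close>)
  then show ?thesis by simp
qed

text \<open>If the total degrees do not balance, \<open>\<omega>\<close> kills both products. If
  they do, both products are evaluated by \<open>\<omega>_word_mult\<close> with the same co-prime
  pair, once in each order.\<close>

lemma \<omega>_words_commute:
  assumes pos: "0 \<le> s" "0 \<le> r" "0 \<le> p" "0 \<le> q" and c: "c \<in> words s r" and d: "d \<in> words p q"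
  shows "\<omega> (c * d) = complex_of_real ((N p / N q) powr \<beta>) * \<omega> (d * c)"
proof (cases "s + p = q + r")
  case False
  have nonneg: "0 \<le> x - inf y x" "0 \<le> x - inf x y" for x y :: 'g
    by (simp_all only: diff_ge_0_iff_ge inf_le1 inf_le2)
  \<comment> \<open>The degrees of a product of words have the same greatest lower bound subtracted
    on both sides, so they can agree only if \<open>s + p = q + r\<close>.\<close>
  have cancel: "a + (b - x) = c + (d - x) \<Longrightarrow> a + b = c + d" for a b c d x :: 'g
    by (simp add: add_diff_eq)
  have "\<omega> (c * d) = 0"
  proof (rule \<omega>_span_words_zero[OF _ _ _ words_mult[OF pos c d]])
    show "s + (p - inf r p) \<noteq> q + (r - inf r p)"
      using False cancel by blast
  qed (intro add_nonneg_nonneg pos nonneg)+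
  moreover have "\<omega> (d * c) = 0"
  proof (rule \<omega>_span_words_zero[OF _ _ _ words_mult[OF pos(3,4,1,2) d c]])
    show "p + (s - inf q s) \<noteq> r + (q - inf q s)"
      using False cancel[of p s _ r q] by (auto simp: add.commute)
  qed (intro add_nonneg_nonneg pos nonneg)+
  ultimately show ?thesis by simp
next
  case True
  define w where "w = inf r p"
  define w' where "w' = inf s q"
  define \<alpha> \<gamma> where "\<alpha> = r - w" and "\<gamma> = p - w"
  have "0 \<le> w" "w \<le> r" "w \<le> p" "inf (r - w) (p - w) = 0" "0 \<le> w'"
    using pos coprime_remainders[of r p] unfolding w_def w'_def by simp_all
  then have w: "0 \<le> w" "0 \<le> w'" "0 \<le> \<alpha>" "0 \<le> \<gamma>" "inf \<alpha> \<gamma> = 0" "r = w + \<alpha>" "p = w + \<gamma>"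
    by (simp_all add: \<alpha>_def \<gamma>_def)
  \<comment> \<open>Balanced degrees make the outer pair \<open>s, q\<close> a translate of the
    inner pair \<open>r, p\<close>. Hence both pairs have the same remainders
    \<open>\<alpha>\<close> and \<open>\<gamma>\<close> over their greatest lower bounds.\<close>
  have q: "q = s - r + p" using True by (simp add: algebra_simps)
  have "w' = inf (s - r + r) (s - r + p)" by (simp add: w'_def q)
  also have "\<dots> = s - r + w" unfolding w_def by (rule add_inf_distrib_left[symmetric])
  finally have w': "w' = s - r + w" .
  have s': "s = w' + \<alpha>" and q': "q = w' + \<gamma>"
    by (simp_all add: w' \<alpha>_def \<gamma>_def q)
  have coprime: "inf \<gamma> \<alpha> = 0" using w(5) by (simp add: inf_commute)
  obtain j a l where c: "c = v s j * \<pi> a * star (v r l)" "j < n s" "l < n r"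
    using c by (auto simp: words_def)
  obtain k b h where d: "d = v p k * \<pi> b * star (v q h)" "k < n p" "h < n q"
    using d by (auto simp: words_def)
  obtain j0 j1 where j: "j0 < n w'" "j1 < n \<alpha>" "j = m w' \<alpha> j0 j1"
    by (rule index_map_surj[OF w(2,3) c(2)[unfolded s']])
  obtain l0 l1 where l: "l0 < n w" "l1 < n \<alpha>" "l = m w \<alpha> l0 l1"
    by (rule index_map_surj[OF w(1,3) c(3)[unfolded w(6)]])
  obtain k0 k1 where k: "k0 < n w" "k1 < n \<gamma>" "k = m w \<gamma> k0 k1"
    by (rule index_map_surj[OF w(1,4) d(2)[unfolded w(7)]])
  obtain h0 h1 where h: "h0 < n w'" "h1 < n \<gamma>" "h = m w' \<gamma> h0 h1"
    by (rule index_map_surj[OF w(2,4) d(3)[unfolded q']])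
  have c': "c = v w' j0 * v \<alpha> j1 * \<pi> a * star (v w l0 * v \<alpha> l1)"
    unfolding c v_mult[OF w(2,3) j(1,2)] v_mult[OF w(1,3) l(1,2)]
    by (simp add: j l flip: s' w(6))
  have d': "d = v w k0 * v \<gamma> k1 * \<pi> b * star (v w' h0 * v \<gamma> h1)"
    unfolding d v_mult[OF w(2,4) h(1,2)] v_mult[OF w(1,4) k(1,2)]
    by (simp add: h k flip: q' w(7))
  let ?K = "\<lambda>z z'. \<omega> (\<pi> (hip (fib X \<gamma>) (u \<gamma> (fst z')) (lact (fib X \<gamma>) a (u \<gamma> (fst z))) *
            hip (fib X \<alpha>) (u \<alpha> (snd z)) (lact (fib X \<alpha>) b (u \<alpha> (snd z')))))"
  define K where "K = (\<Sum>z\<in>matching \<alpha> \<gamma> l1 k1. \<Sum>z'\<in>matching \<alpha> \<gamma> j1 h1. ?K z z')"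
  have cd: "\<omega> (c * d) =
      (if l0 = k0 \<and> j0 = h0 then complex_of_real (N (w' + \<alpha> + \<gamma>) powr (- \<beta>)) * K else 0)"
    unfolding c' d' K_def by (rule \<omega>_word_mult[OF w(1-5) j(1,2) l(1,2) k(1,2) h(1,2)])
  text \<open>By the trace property on \<open>A\<close>, exchanging the two words only transposes the double sum.\<close>
  have "(\<Sum>z'\<in>matching \<gamma> \<alpha> h1 j1. \<Sum>z\<in>matching \<gamma> \<alpha> k1 l1.
         \<omega> (\<pi> (hip (fib X \<alpha>) (u \<alpha> (fst z)) (lact (fib X \<alpha>) b (u \<alpha> (fst z'))) *
            hip (fib X \<gamma>) (u \<gamma> (snd z')) (lact (fib X \<gamma>) a (u \<gamma> (snd z)))))) = K"
    unfolding K_def matching_swap[of \<gamma> \<alpha>] sum.reindex[OF inj_on_subset[OF inj_swap subset_UNIV]]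
    by (subst sum.swap) (simp add: \<omega>_\<pi>_trace)
  then have "\<omega> (d * c) =
      (if h0 = j0 \<and> k0 = l0 then complex_of_real (N (w + \<gamma> + \<alpha>) powr (- \<beta>)) * K else 0)"
    unfolding c' d'
    using \<omega>_word_mult[OF w(2,1,4,3) coprime k(1,2) h(1,2) j(1,2) l(1,2), of b a] by simp
  \<comment> \<open>Since \<open>p = w + \<gamma>\<close> and \<open>q = w' + \<gamma>\<close>, the
    quotient of \<open>N p\<close> by \<open>N q\<close> is that of \<open>N w\<close> by
    \<open>N w'\<close>, which exchanges \<open>w\<close> for \<open>w'\<close> in the
    scalar.\<close>
  moreover have "(N p / N q) powr \<beta> * N (w + \<gamma> + \<alpha>) powr (- \<beta>) = N (w' + \<alpha> + \<gamma>) powr (- \<beta>)"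
    unfolding w(7) q' N_add using N_pos
    by (simp add: powr_mult powr_divide powr_minus less_imp_le less_imp_neq[OF N_pos, symmetric] field_simps)
  ultimately show ?thesis
    unfolding cd by (auto simp flip: of_real_mult mult.assoc)
qed

text \<open>The scalar depends on the degrees of \<open>d\<close> alone, so density of the words
  lets the other factor be arbitrary.\<close>

lemma \<omega>_commute_word:
  assumes p: "0 \<le> p" and q: "0 \<le> q" and d: "d \<in> words p q"
  shows "\<omega> (c * d) = complex_of_real ((N p / N q) powr \<beta>) * \<omega> (d * c)"
proof (rule bounded_functionals_eq_on_closed_span[where x = c and G = all_words
      and L = "\<lambda>c. \<omega> (c * d)" and M = "\<lambda>c. \<omega> (d * c)"])
  show "c \<in> closure (csubspace hull all_words)" by (simp add: closure_all_words)
  show "bounded_functional (\<lambda>c. \<omega> (c * d))" "bounded_functional (\<lambda>c. \<omega> (d * c))"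
    by (intro bounded_functional_mult_left bounded_functional_mult_right \<omega>_bounded)+
  show "\<omega> (g * d) = complex_of_real ((N p / N q) powr \<beta>) * \<omega> (d * g)" if "g \<in> all_words" for g
    using that \<omega>_words_commute[OF _ _ p q _ d] by (auto simp: all_words_def)
qed

text \<open>For words of equal degrees the scalar is 1, and such words have the core in their closed
  span.\<close>

lemma \<omega>_trace_core:
  assumes x: "x \<in> core X i"
  shows "\<omega> (c * x) = \<omega> (x * c)"
proof -
  have "\<omega> (c * x) = 1 * \<omega> (x * c)"
  proof (rule bounded_functionals_eq_on_closed_span[where L = "\<lambda>x. \<omega> (c * x)" and M = "\<lambda>x. \<omega> (x * c)"])
    show "x \<in> closure (csubspace hull (\<Union>s\<in>{0..}. words s s))"
      using x core_subset by blast
    show "bounded_functional (\<lambda>x. \<omega> (c * x))" "bounded_functional (\<lambda>x. \<omega> (x * c))"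
      by (intro bounded_functional_mult_left bounded_functional_mult_right \<omega>_bounded)+
    show "\<omega> (c * g) = 1 * \<omega> (g * c)" if "g \<in> (\<Union>s\<in>{0..}. words s s)" for g
      using that \<omega>_commute_word[of _ _ g c] N_pos by (auto simp: less_imp_neq[symmetric])
  qed
  then show ?thesis by simp
qed

section \<open>Dynamics, invariance and the KMS condition\<close>

lemma scaling_dynamics_word:
  assumes \<sigma>: "scaling_dynamics X i N \<sigma>" and s: "0 \<le> s" and r: "0 \<le> r" and x: "x \<in> words s r"
  shows "\<sigma> t x = exp (\<i> * complex_of_real t * complex_of_real (ln (N s) - ln (N r))) *\<^sub>C x"
proof -
  obtain j a l where jl: "x = v s j * \<pi> a * star (v r l)" "j < n s" "l < n r"
    using x by (auto simp: words_def)
  have hom: "\<sigma> t (y * z) = \<sigma> t y * \<sigma> t z" "\<sigma> t (star y) = star (\<sigma> t y)" for y z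
    using \<sigma> by (simp_all add: scaling_dynamics_def dynamics_def star_hom_def type_alg_def)
  have "\<sigma> t (i p \<xi>) = exp (\<i> * complex_of_real t * complex_of_real (ln (N p))) *\<^sub>C i p \<xi>"
    if "0 \<le> p" "\<xi> \<in> fsp X p" for p \<xi>
  proof -
    have "Ln (complex_of_real (N p)) = complex_of_real (ln (N p))"
      using N_pos[of p] by (simp add: Ln_of_real)
    then show ?thesis
      using \<sigma> that N_pos[of p] by (simp add: scaling_dynamics_def powr_def)
  qed
  then have v: "\<sigma> t (v s j) = exp (\<i> * complex_of_real t * complex_of_real (ln (N s))) *\<^sub>C v s j"
    "\<sigma> t (v r l) = exp (\<i> * complex_of_real t * complex_of_real (ln (N r))) *\<^sub>C v r l"
    using s r jl by (simp_all add: basis_in)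
  have "\<sigma> t (\<pi> a) = \<pi> a" using \<sigma> by (simp add: scaling_dynamics_def)
  then show ?thesis
    unfolding jl(1)
    by (simp add: hom v star_scaleC mult_scaleC_left mult_scaleC_right scaleC_scaleC exp_cnj
        right_diff_distrib exp_diff exp_minus field_simps)
qed

text \<open>On a word either both degrees agree and the phase is 1, or \<open>\<omega>\<close>
  vanishes.\<close>

lemma \<omega>_invariant:
  assumes \<sigma>: "scaling_dynamics X i N \<sigma>" and pos: "\<And>x. \<omega> (star x * x) \<in> \<real>\<^sub>\<ge>\<^sub>0"
  shows "\<omega> (\<sigma> t x) = \<omega> x"
proof -
  have hom: "\<sigma> t (y * z) = \<sigma> t y * \<sigma> t z" "\<sigma> t (star y) = star (\<sigma> t y)"
    "\<sigma> t (y + z) = \<sigma> t y + \<sigma> t z" "\<sigma> t (c *\<^sub>C y) = c *\<^sub>C \<sigma> t y" for y z c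
    using \<sigma> by (simp_all add: scaling_dynamics_def dynamics_def star_hom_def type_alg_def)
  have \<omega>_scale: "\<omega> (c *\<^sub>C y) = c * \<omega> y" and \<omega>_add: "\<omega> (y + z) = \<omega> y + \<omega> z" for c y z
    using \<omega>_bounded by (simp_all add: bounded_functional_def)
  have "\<omega> (\<sigma> t x) = 1 * \<omega> x"
  proof (rule bounded_functionals_eq_on_closed_span[where G = all_words and L = "\<lambda>x. \<omega> (\<sigma> t x)" and M = \<omega>])
    show "x \<in> closure (csubspace hull all_words)" by (simp add: closure_all_words)
    show "bounded_functional (\<lambda>x. \<omega> (\<sigma> t x))"
      by (rule positive_functional_bounded) (simp_all add: hom \<omega>_add \<omega>_scale pos)
    show "bounded_functional \<omega>" by (rule \<omega>_bounded)
    fix g assume "g \<in> all_words"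
    then obtain s r where g: "0 \<le> s" "0 \<le> r" "g \<in> words s r" by (auto simp: all_words_def)
    show "\<omega> (\<sigma> t g) = 1 * \<omega> g"
    proof (cases "s = r")
      case False
      have "\<omega> g = 0" by (rule \<omega>_span_words_zero[OF g(1,2) False hull_inc[OF g(3)]])
      then show ?thesis by (simp add: scaling_dynamics_word[OF \<sigma> g] \<omega>_scale)
    qed (simp add: scaling_dynamics_word[OF \<sigma> g] scaleC_one)
  qed
  then show ?thesis by simp
qed

text \<open>Against a fixed word \<open>d\<close>, the entire function \<open>z \<mapsto> \<omega> (d \<sigma>\<^sub>z(c))\<close> is a multiple of an
  exponential on the real axis, hence everywhere.\<close>

lemma \<omega>_kms:
  assumes \<sigma>: "scaling_dynamics X i N \<sigma>" and pos: "\<And>x. \<omega> (star x * x) \<in> \<real>\<^sub>\<ge>\<^sub>0"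
    and f: "entire_extension \<sigma> c f"
  shows "\<omega> (c * d) = \<omega> (d * f (\<i> * complex_of_real \<beta>))"
proof -
  have "\<omega> (c * d) = 1 * \<omega> (d * f (\<i> * complex_of_real \<beta>))"
  proof (rule bounded_functionals_eq_on_closed_span[where G = all_words and L = "\<lambda>d. \<omega> (c * d)"
        and M = "\<lambda>d. \<omega> (d * f (\<i> * complex_of_real \<beta>))"])
    show "d \<in> closure (csubspace hull all_words)" by (simp add: closure_all_words)
    show "bounded_functional (\<lambda>d. \<omega> (c * d))"
      "bounded_functional (\<lambda>d. \<omega> (d * f (\<i> * complex_of_real \<beta>)))"
      by (intro bounded_functional_mult_left bounded_functional_mult_right \<omega>_bounded)+
    fix d assume "d \<in> all_words"
    then obtain p q where d: "0 \<le> p" "0 \<le> q" "d \<in> words p q" by (auto simp: all_words_def)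
    define \<theta> where "\<theta> = complex_of_real (ln (N p) - ln (N q))"
    \<comment> \<open>\<open>H\<close> is the deviation of \<open>\<omega> (d * f z)\<close> from
      the exponential dictated by invariance; it has to vanish at
      \<open>\<i> * \<beta>\<close>.\<close>
    define H where "H z = \<omega> (d * f z) - exp (- (\<i> * z * \<theta>)) * \<omega> (d * c)" for z
    have lin: "bounded_functional (\<lambda>x. \<omega> (d * x))"
      by (rule bounded_functional_mult_right[OF \<omega>_bounded])
    have "(\<lambda>z. \<omega> (d * f z)) holomorphic_on UNIV"
      unfolding holomorphic_on_def field_differentiable_def
    proof
      fix z
      obtain D where D: "((\<lambda>w. (1 / (w - z)) *\<^sub>C (f w - f z)) \<longlongrightarrow> D) (at z)"
        using f by (auto simp: entire_extension_def entire_def)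
      have "((\<lambda>w. \<omega> (d * ((1 / (w - z)) *\<^sub>C (f w - f z)))) \<longlongrightarrow> \<omega> (d * D)) (at z)"
        by (rule bounded_linear.tendsto[OF bounded_functional_bounded_linear[OF lin] D])
      moreover have "\<omega> (d * ((1 / (w - z)) *\<^sub>C (f w - f z))) =
          (\<omega> (d * f w) - \<omega> (d * f z)) / (w - z)" for w
        using lin bounded_functional_diff[OF lin, of "f w" "f z"] by (simp add: bounded_functional_def)
      ultimately show "\<exists>D. ((\<lambda>z. \<omega> (d * f z)) has_field_derivative D) (at z)"
        by (auto simp: has_field_derivative_iff)
    qed
    then have holomorphic: "H holomorphic_on UNIV"
      unfolding H_def by (intro holomorphic_intros)
    have real_axis: "H z = 0" if "z \<in> \<real>" for z
    proof -
      obtain t where t: "z = complex_of_real t" using \<open>z \<in> \<real>\<close> by (auto elim: Reals_cases)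
      \<comment> \<open>By multiplicativity of \<open>\<sigma> t\<close>, the word \<open>d\<close>
        contributes its phase and \<open>c\<close> contributes \<open>f\<close> at the real point
        \<open>t\<close>.\<close>
      have "\<omega> (d * c) = \<omega> (\<sigma> t (d * c))" by (simp add: \<omega>_invariant[OF \<sigma> pos])
      also have "\<sigma> t (d * c) = exp (\<i> * z * \<theta>) *\<^sub>C (d * f z)"
        using \<sigma> f by (simp add: scaling_dynamics_word[OF \<sigma> d] scaling_dynamics_def dynamics_def
            star_hom_def type_alg_def mult_scaleC_left entire_extension_def t \<theta>_def)
      also have "\<omega> \<dots> = exp (\<i> * z * \<theta>) * \<omega> (d * f z)"
        using \<omega>_bounded by (simp add: bounded_functional_def)
      finally show ?thesis by (simp add: H_def exp_minus)
    qed
    have limit_point: "(0::complex) islimpt \<real>"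
      unfolding islimpt_approachable
    proof (intro allI impI)
      fix e :: real assume e: "0 < e"
      have "complex_of_real (e / 2) \<in> \<real>" "complex_of_real (e / 2) \<noteq> 0"
        using e by simp_all
      moreover have "dist (complex_of_real (e / 2)) 0 < e"
        using e by (simp add: dist_norm norm_divide)
      ultimately show "\<exists>x'\<in>\<real>. x' \<noteq> (0::complex) \<and> dist x' 0 < e" by blast
    qed
    have "H (\<i> * complex_of_real \<beta>) = 0"
      by (rule analytic_continuation[OF holomorphic open_UNIV connected_UNIV subset_UNIV UNIV_I
            limit_point real_axis UNIV_I])
    \<comment> \<open>At \<open>\<i> * \<beta>\<close> the exponential becomes exactly the scalar of
      \<open>\<omega>_commute_word\<close>.\<close>
    moreover have "exp (- (\<i> * (\<i> * complex_of_real \<beta>) * \<theta>)) = complex_of_real ((N p / N q) powr \<beta>)"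
    proof -
      have "- (\<i> * (\<i> * complex_of_real \<beta>) * \<theta>) = complex_of_real (\<beta> * ln (N p / N q))"
        using N_pos[of p] N_pos[of q] by (simp add: \<theta>_def ln_div flip: mult.assoc)
      then show ?thesis
        using N_pos[of p] N_pos[of q] by (simp only: exp_of_real) (simp add: powr_def)
    qed
    ultimately show "\<omega> (c * d) = 1 * \<omega> (d * f (\<i> * complex_of_real \<beta>))"
      by (simp add: \<omega>_commute_word[OF d] H_def)
  qed
  then show ?thesis by simp
qed

end

section \<open>From the state on the core to the whole algebra\<close>

theorem theorem4p6:
  fixes X :: "('g::lattice_ab_group_add, 'a::cstar_algebra, 'x::complex_vector) prodsys"
    and n :: "'g \<Rightarrow> nat"
    and u :: "'g \<Rightarrow> nat \<Rightarrow> 'x"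
    and m :: "'g \<Rightarrow> 'g \<Rightarrow> nat \<Rightarrow> nat \<Rightarrow> nat"
    and i :: "'g \<Rightarrow> 'x \<Rightarrow> 'b::cstar_algebra"
    and E :: "'b \<Rightarrow> 'b"
    and N :: "'g \<Rightarrow> real"
    and \<sigma> :: "real \<Rightarrow> 'b \<Rightarrow> 'b"
    and \<phi> :: "'b \<Rightarrow> complex"
    and \<beta> :: real
  assumes "product_system X"
    and "associative_system X"
    and "finite_type X n u m"
    and "bijective_maps n m"
    and "respects_coprime n m"
    and "nica_toeplitz_algebra X i"
    and "core_expectation X i E"
    and "positive_hom N"
    and "inj N"
    and "scaling_dynamics X i N \<sigma>"
    and "state_on (core X i) \<phi>"
    and "tracial_on (range (\<lambda>a. i 0 (emb X a))) \<phi>"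
    and "0 < \<beta>"
    and "\<And>a s j l. \<lbrakk>0 \<le> s; j < n s; l < n s\<rbrakk> \<Longrightarrow>
      \<phi> (i s (u s j) * i 0 (emb X a) * star (i s (u s l))) =
      (if j = l then complex_of_real (N s powr (- \<beta>)) * \<phi> (i 0 (emb X a)) else 0)"
  shows "tracial_on (core X i) \<phi> \<and> kms_state \<sigma> \<beta> (\<phi> \<circ> E)"
proof -
  interpret nica_toeplitz_finite_type X n u m i
    by unfold_locales (fact assms)+
  let ?C = "core X i" and ?\<omega> = "\<phi> \<circ> E"
  have csub: "csubspace ?C"
    unfolding core_def by (rule csubspace_closure[OF csubspace_hull])
  have E_in: "E x \<in> ?C" and E_id: "x \<in> ?C \<Longrightarrow> E x = x"
    and E_add: "E (x + y) = E x + E y" and E_scale: "E (c *\<^sub>C x) = c *\<^sub>C E x"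
    and E_norm: "norm (E x) \<le> norm x" and E_pos: "positive_in ?C (E (star x * x))"
    and E_bimod: "a \<in> ?C \<Longrightarrow> b \<in> ?C \<Longrightarrow> E (a * x * b) = a * E x * b" for a b c x y
    using assms(7) by (simp_all add: core_expectation_def conditional_expectation_def)
  have E_i: "E (i s \<xi> * star (i r \<eta>)) = (if s = r then i s \<xi> * star (i s \<eta>) else 0)"
    if "0 \<le> s" "0 \<le> r" "\<xi> \<in> fsp X s" "\<eta> \<in> fsp X r" for s r \<xi> \<eta>
    using assms(7) that by (simp add: core_expectation_def)
  have \<phi>_add: "x \<in> ?C \<Longrightarrow> y \<in> ?C \<Longrightarrow> \<phi> (x + y) = \<phi> x + \<phi> y"
    and \<phi>_scale: "x \<in> ?C \<Longrightarrow> \<phi> (c *\<^sub>C x) = c * \<phi> x"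
    and \<phi>_pos: "x \<in> ?C \<Longrightarrow> \<phi> (star x * x) \<in> \<real>\<^sub>\<ge>\<^sub>0"
    and bdd: "bdd_above ((\<lambda>x. cmod (\<phi> x)) ` {x \<in> ?C. norm x \<le> 1})"
    and sup: "(SUP x\<in>{x \<in> ?C. norm x \<le> 1}. cmod (\<phi> x)) = 1" for x y c
    using assms(11) by (simp_all add: state_on_def)
  have zero: "0 \<in> ?C" using csub by (simp add: csubspace_def)
  have \<phi>_zero: "\<phi> 0 = 0" using \<phi>_scale[OF zero, of 0] by (simp add: scaleC_zero_left)
  \<comment> \<open>Normalising \<open>x\<close> turns the supremum condition of a state into
    contractivity; this and contractivity of \<open>E\<close> bound
    \<open>\<phi> \<circ> E\<close>.\<close>
  have \<phi>_norm: "cmod (\<phi> x) \<le> norm x" if x: "x \<in> ?C" for x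
  proof (cases "x = 0")
    case False
    let ?r = "complex_of_real (1 / norm x)"
    have "?r *\<^sub>C x \<in> ?C" using csub x by (simp add: csubspace_def)
    moreover have "norm (?r *\<^sub>C x) \<le> 1" using False by (simp add: norm_scaleC norm_divide)
    ultimately have "cmod (\<phi> (?r *\<^sub>C x)) \<le> 1"
      using cSUP_upper[OF _ bdd, of "?r *\<^sub>C x"] sup by simp
    then show ?thesis using False by (simp add: \<phi>_scale[OF x] norm_mult norm_divide field_simps)
  qed (simp add: \<phi>_zero)
  have \<omega>_norm: "cmod (?\<omega> x) \<le> norm x" for x
    using \<phi>_norm[OF E_in, of x] E_norm[of x] by simp
  have bounded: "bounded_functional ?\<omega>"
    unfolding bounded_functional_def
  proof (intro conjI allI exI[of _ 1])
    show "cmod (?\<omega> x) \<le> 1 * norm x" for x using \<omega>_norm[of x] by simp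
  qed (simp_all add: E_add E_scale \<phi>_add \<phi>_scale E_in)
  have E_\<pi>: "E (\<pi> a) = \<pi> a" for a
    using E_i[of 0 0 "emb X a" "emb X 1"] by (simp add: emb_in \<pi>_one star_one)
  interpret kms_functional X n u m i N \<beta> ?\<omega>
  proof unfold_locales
    show "positive_hom N" by fact
    show "bounded_functional ?\<omega>" by fact
    show "?\<omega> (\<pi> (a * b)) = ?\<omega> (\<pi> (b * a))" for a b
    proof -
      have "\<phi> (\<pi> a * \<pi> b) = \<phi> (\<pi> b * \<pi> a)"
        using assms(12) unfolding tracial_on_def by blast
      then show ?thesis by (simp only: comp_apply E_\<pi> \<pi>_mult[symmetric])
    qed
  next
    fix s r j l a assume s: "0 \<le> s" "0 \<le> r" "j < n s" "l < n r"
    have "E (v s j * \<pi> a * star (v r l)) = (if s = r then v s j * \<pi> a * star (v s l) else 0)"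
      \<comment> \<open>The coefficient \<open>a\<close> is absorbed into the left vector by the
        right action, which brings the word into the form on which \<open>E\<close> is
        prescribed.\<close>
      using E_i[of s r "ract (fib X s) (u s j) a" "u r l"] s
      by (auto simp: i_ract basis_in hilbert_mod.ract_in[OF hilbert_mod])
    then show "?\<omega> (v s j * \<pi> a * star (v r l)) =
      (if s = r \<and> j = l then complex_of_real (N s powr (- \<beta>)) * ?\<omega> (\<pi> a) else 0)"
      using s assms(14)[of s j l a] by (auto simp: E_\<pi> \<phi>_zero)
  qed
  have one: "1 \<in> ?C" using E_in[of "\<pi> 1"] E_\<pi>[of 1] by (simp add: \<pi>_one)
  \<comment> \<open>The bimodule property with middle factor 1 shows that \<open>E\<close> fixes
    products of core elements, so \<open>\<phi>\<close> and \<open>\<phi> \<circ> E\<close> agree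
    there.\<close>
  have E_mult: "E (x * y) = x * y" if "x \<in> ?C" "y \<in> ?C" for x y
    using E_bimod[OF that, of 1] E_id[OF one] by simp
  have "tracial_on ?C \<phi>"
    unfolding tracial_on_def
  proof (intro ballI)
    fix x y assume "x \<in> ?C" "y \<in> ?C"
    then show "\<phi> (x * y) = \<phi> (y * x)"
      using \<omega>_trace_core[of y x] by (simp add: E_mult)
  qed
  moreover have \<omega>_pos: "?\<omega> (star x * x) \<in> \<real>\<^sub>\<ge>\<^sub>0" for x
    using E_pos[of x] \<phi>_pos by (auto simp: positive_in_def)
  have "state_on UNIV ?\<omega>"
    unfolding state_on_def
  proof (intro conjI ballI allI)
    have le: "cmod (?\<omega> x) \<le> 1" if "norm x \<le> 1" for x
      using \<omega>_norm[of x] that by simp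
    show bdd': "bdd_above ((\<lambda>x. cmod (?\<omega> x)) ` {x \<in> UNIV. norm x \<le> 1})"
      by (rule bdd_aboveI2[of _ _ 1], rule le) simp
    show "(SUP x\<in>{x \<in> UNIV. norm x \<le> 1}. cmod (?\<omega> x)) = 1"
    proof (rule antisym)
      show "(SUP x\<in>{x \<in> UNIV. norm x \<le> 1}. cmod (?\<omega> x)) \<le> 1"
      proof (rule cSUP_least)
        have "(0::'b) \<in> {x \<in> UNIV. norm x \<le> 1}" by simp
        then show "{x \<in> UNIV. norm (x::'b) \<le> 1} \<noteq> {}" by blast
      qed (rule le, simp)
      \<comment> \<open>\<open>E\<close> fixes the core, so the supremum over the whole unit ball
        dominates the one over the core, which is 1.\<close>
      have "cmod (\<phi> x) \<le> (SUP x\<in>{x \<in> UNIV. norm x \<le> 1}. cmod (?\<omega> x))"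
        if "x \<in> ?C" "norm x \<le> 1" for x
        using cSUP_upper[OF _ bdd', of x] that E_id[of x] by simp
      then have "(SUP x\<in>{x \<in> ?C. norm x \<le> 1}. cmod (\<phi> x)) \<le>
          (SUP x\<in>{x \<in> UNIV. norm x \<le> 1}. cmod (?\<omega> x))"
      proof (intro cSUP_least)
        have "0 \<in> {x \<in> ?C. norm x \<le> 1}" using zero by simp
        then show "{x \<in> ?C. norm x \<le> 1} \<noteq> {}" by blast
      qed simp
      then show "1 \<le> (SUP x\<in>{x \<in> UNIV. norm x \<le> 1}. cmod (?\<omega> x))"
        by (simp only: sup)
    qed
  qed (use \<omega>_pos in \<open>simp_all add: E_add E_scale \<phi>_add \<phi>_scale E_in\<close>)
  moreover have "?\<omega> (c * d) = ?\<omega> (d * f (\<i> * complex_of_real \<beta>))"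
    if "entire_extension \<sigma> c f" for c d f
    by (rule \<omega>_kms[OF assms(10) \<omega>_pos that])
  ultimately show ?thesis
    unfolding kms_state_def by blast
qed

end
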